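(* For any sets of formulas $\Sigma,\Gamma\subseteq\mathit{Fm}_I$ and any formula $\varphi\in\mathit{Fm}_I$, $$\Gamma\vdash_l\varphi\iff\Gamma\Vdash_l\varphi\iff\Gamma\models_l\varphi$$ and $$\Sigma\vdash_g\varphi\iff\Sigma\Vdash_g\varphi\iff\Sigma\models_g\varphi .$$
   Context: Fix a finite non-empty set $I$. **Formulas.** $\mathit{Fm}_I$ is the set of formulas built from countably many propositional variables $p_0,p_1,\dots$ and the constant $\bot$ using $\to$, unary connectives $\Box_i$ ($i\in I$) and a unary connective $\mathsf{C}$. Abbreviations: $\neg\varphi:=\varphi\to\bot$, $\top:=\neg\bot$, $\varphi\wedge\psi:=\neg(\varphi\to\neg\psi)$, $\varphi\vee\psi:=\neg\varphi\to\psi$, $\mathsf{E}\varphi:=\bigwedge_{i\in I}\Box_i\varphi$. An empty conjunction is $\top$. **The logic $\mathsf{S4}^C_I$** is given by the axiom schemas: (i) classical propositional tautologies (in this language); (ii) $\Box_i(\varphi\to\psi)\to(\Box_i\varphi\to\Box_i\psi)$; (iii) $\Box_i\varphi\to\Box_i\Box_i\varphi$; (iv) $\Box_i\varphi\to\varphi$; (v) $\mathsf{C}(\varphi\to\psi)\to(\mathsf{C}\varphi\to\mathsf{C}\psi)$; (vi) $\mathsf{C}\varphi\to\mathsf{E}\varphi\wedge\mathsf{E}\mathsf{C}\varphi$; (vii) $\mathsf{E}\varphi\wedge\mathsf{C}(\varphi\to\mathsf{E}\varphi)\to\mathsf{C}\varphi$ (for all $i\in I$), and the rules ($\mathsf{mp}$)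 from $\varphi$ and $\varphi\to\psi$ infer $\psi$; ($\mathsf{nec}$) from $\varphi$ infer $\mathsf{C}\varphi$. $\mathsf{S4}^C_I\vdash\varphi$ means $\varphi$ is a theorem of this (finitary) calculus. **Derivability.** $\Gamma\vdash_l\varphi$ means there is a finite $\Gamma_0\subseteq\Gamma$ with $\mathsf{S4}^C_I\vdash\bigwedge\Gamma_0\to\varphi$. An $\omega$-derivation is a well-founded tree whose nodes are marked by formulas and which is constructed according to the rules ($\mathsf{mp}$), ($\mathsf{nec}$) and the rule ($\omega$): from the infinitely many premises $\varphi_j\to\mathsf{E}\psi\wedge\mathsf{E}\varphi_{j+1}$ ($j\in\mathbb{N}$) infer $\varphi_0\to\mathsf{C}\psi$. An assumption leaf is a leaf not marked by an axiom. $\Sigma\vdash_g\varphi$ means there is an $\omega$-derivation with root marked by $\varphi$ in which all assumption leaves are marked by elements of $\Sigma$. **Algebras.** An interior algebra is a Boolean algebra with a unary operation $\Box$ such that $\Box1=1$, $\Box(x\wedge y)=\Box x\wedge\Box y$, $\Box x=\Box\Box x$, $\Box x\le x$. An $\mathsf{S4}^C_I$-algebra is a Boolean algebra $A$ with unary operations $\Box_i$ ($i\in I$) and $\mathsf{C}$ such that each $\Box_i$ and $\mathsf{C}$ make $A$ an interior algebra, and $\mathsf{C}a\le\mathsf{E}a\wedge\mathsf{E}\mathsf{C}a$ and $\mathsf{E}a\wedge\mathsf{C}(a\to\mathsf{E}a)\le\mathsf{C}a$ for all $a\in A$, where $\mathsf{E}a:=\bigwedge_{i\in I}\Box_i a$.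 It is standard if, for every element $d$ and every sequence $(a_j)_{j\in\mathbb{N}}$ with $a_j\le\mathsf{E}d\wedge\mathsf{E}a_{j+1}$ for all $j$, we have $a_0\le\mathsf{C}d$. A valuation in an $\mathsf{S4}^C_I$-algebra with carrier $A$ is a map $v:\mathit{Fm}_I\to A$ with $v(\bot)=0$, $v(\varphi\to\psi)=v(\varphi)\to v(\psi)$, $v(\Box_i\varphi)=\Box_iv(\varphi)$, $v(\mathsf{C}\varphi)=\mathsf{C}v(\varphi)$. $\langle S\rangle$ denotes the filter generated by $S\subseteq A$. **Algebraic consequence.** $\Gamma\Vdash_l\varphi$ means: for every standard $\mathsf{S4}^C_I$-algebra and every valuation $v$ in it, $v(\varphi)\in\langle\{v(\psi)\mid\psi\in\Gamma\}\rangle$. $\Sigma\Vdash_g\varphi$ means: for every standard $\mathsf{S4}^C_I$-algebra and every valuation $v$ in it, if $v(\xi)=1$ for all $\xi\in\Sigma$, then $v(\varphi)=1$. **Topological consequence.** A topological $\mathsf{S4}^C_I$-model $\mathcal{M}$ consists of a set $X$, a family of topologies $(\tau_i)_{i\in I}$ on $X$, and a map $v:\mathit{Fm}_I\to\mathcal{P}(X)$ with $v(\bot)=\emptyset$, $v(\varphi\to\psi)=v(\psi)\cup(X\setminus v(\varphi))$, $v(\Box_i\varphi)=\mathrm{Int}_{\tau_i}(v(\varphi))$, $v(\mathsf{C}\varphi)=\mathrm{Int}_\tau(v(\varphi))$, where $\tau=\bigcap_{i\in I}\tau_i$ and $\mathrm{Int}$ denotes interior. $\mathcal{M},x\models\varphi$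 means $x\in v(\varphi)$; $\mathcal{M}\models\varphi$ means $v(\varphi)=X$. $\Gamma\models_l\varphi$ means: for every topological $\mathsf{S4}^C_I$-model $\mathcal{M}$ and every point $x$ of it, if $\mathcal{M},x\models\psi$ for all $\psi\in\Gamma$, then $\mathcal{M},x\models\varphi$. $\Sigma\models_g\varphi$ means: for every topological $\mathsf{S4}^C_I$-model $\mathcal{M}$, if $\mathcal{M}\models\xi$ for all $\xi\in\Sigma$, then $\mathcal{M}\models\varphi$. *)

theory Defs
  imports "HOL-Analysis.Abstract_Topology"
begin

section \<open>Formulas\<close>

text \<open>The finite non-empty index set is the universe of a type of class \<open>finite\<close>.\<close>

datatype 'i fm =
    Var nat
  | Fls
  | Imp "'i fm" "'i fm"  (infixr \<open>\<^bold>\<rightarrow>\<close> 55)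
  | Box 'i "'i fm"
  | Com "'i fm"

abbreviation Neg :: "'i fm \<Rightarrow> 'i fm" where
  "Neg p \<equiv> p \<^bold>\<rightarrow> Fls"

abbreviation Tru :: "'i fm" where
  "Tru \<equiv> Neg Fls"

abbreviation Conj :: "'i fm \<Rightarrow> 'i fm \<Rightarrow> 'i fm"  (infixr \<open>\<^bold>\<and>\<close> 65) where
  "p \<^bold>\<and> q \<equiv> Neg (p \<^bold>\<rightarrow> Neg q)"

fun big_conj :: "'i fm list \<Rightarrow> 'i fm" where
  "big_conj [] = Tru"
| "big_conj [p] = p"
| "big_conj (p # q # ps) = p \<^bold>\<and> big_conj (q # ps)"

text \<open>An arbitrary but fixed enumeration of the indices, used to write the
  finite conjunctions over all indices.\<close>

definition index_list :: "'i::finite list" where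
  "index_list = (SOME xs. set xs = UNIV \<and> distinct xs)"

lemma index_list: "set index_list = (UNIV :: 'i::finite set)" "distinct (index_list :: 'i list)"
proof -
  have "\<exists>xs. set xs = (UNIV :: 'i set) \<and> distinct xs"
    using finite_distinct_list[OF finite] by blast
  then have "set index_list = (UNIV :: 'i set) \<and> distinct (index_list :: 'i list)"
    unfolding index_list_def by (rule someI_ex)
  then show "set index_list = (UNIV :: 'i set)" "distinct (index_list :: 'i list)"
    by auto
qed

definition Everyone :: "'i::finite fm \<Rightarrow> 'i fm" where
  "Everyone p = big_conj (map (\<lambda>i. Box i p) index_list)"


section \<open>The calculus\<close>

text \<open>Variables and modal formulas are all treated as propositional atoms.\<close>

fun prop_eval :: "('i fm \<Rightarrow> bool) \<Rightarrow> 'i fm \<Rightarrow> bool" where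
  "prop_eval h Fls = False"
| "prop_eval h (p \<^bold>\<rightarrow> q) = (prop_eval h p \<longrightarrow> prop_eval h q)"
| "prop_eval h p = h p"

definition tautology :: "'i fm \<Rightarrow> bool" where
  "tautology p \<longleftrightarrow> (\<forall>h. prop_eval h p)"

inductive S4C_axiom :: "'i::finite fm \<Rightarrow> bool" where
  taut: "tautology p \<Longrightarrow> S4C_axiom p"
| box_K: "S4C_axiom (Box i (p \<^bold>\<rightarrow> q) \<^bold>\<rightarrow> Box i p \<^bold>\<rightarrow> Box i q)"
| box_4: "S4C_axiom (Box i p \<^bold>\<rightarrow> Box i (Box i p))"
| box_T: "S4C_axiom (Box i p \<^bold>\<rightarrow> p)"
| com_K: "S4C_axiom (Com (p \<^bold>\<rightarrow> q) \<^bold>\<rightarrow> Com p \<^bold>\<rightarrow> Com q)"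
| com_unfold: "S4C_axiom (Com p \<^bold>\<rightarrow> Everyone p \<^bold>\<and> Everyone (Com p))"
| com_induct: "S4C_axiom (Everyone p \<^bold>\<and> Com (p \<^bold>\<rightarrow> Everyone p) \<^bold>\<rightarrow> Com p)"

inductive S4C_theorem :: "'i::finite fm \<Rightarrow> bool" where
  ax: "S4C_axiom p \<Longrightarrow> S4C_theorem p"
| mp: "S4C_theorem p \<Longrightarrow> S4C_theorem (p \<^bold>\<rightarrow> q) \<Longrightarrow> S4C_theorem q"
| nec: "S4C_theorem p \<Longrightarrow> S4C_theorem (Com p)"

definition derivable_local :: "'i::finite fm set \<Rightarrow> 'i fm \<Rightarrow> bool"  (infix \<open>\<turnstile>\<^sub>l\<close> 50) where
  "\<Gamma> \<turnstile>\<^sub>l p \<longleftrightarrow> (\<exists>ps. set ps \<subseteq> \<Gamma> \<and> S4C_theorem (big_conj ps \<^bold>\<rightarrow> p))"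

text \<open>Trees whose nodes are marked by formulas; elements of a datatype are well-founded.
  Each inner node also records which rule is applied at it.\<close>

datatype 'i deriv_tree =
    Leaf "'i fm"
  | MP "'i fm" "'i deriv_tree" "'i deriv_tree"
  | Nec "'i fm" "'i deriv_tree"
  | Omega "'i fm" "nat \<Rightarrow> 'i deriv_tree"

fun root :: "'i deriv_tree \<Rightarrow> 'i fm" where
  "root (Leaf p) = p"
| "root (MP p d e) = p"
| "root (Nec p d) = p"
| "root (Omega p ds) = p"

primrec omega_derivation :: "'i::finite deriv_tree \<Rightarrow> bool" where
  "omega_derivation (Leaf p) \<longleftrightarrow> True"
| "omega_derivation (MP p d e) \<longleftrightarrow>
     root e = (root d \<^bold>\<rightarrow> p) \<and> omega_derivation d \<and> omega_derivation e"
| "omega_derivation (Nec p d) \<longleftrightarrow> p = Com (root d) \<and> omega_derivation d"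
| "omega_derivation (Omega p ds) \<longleftrightarrow>
     (\<exists>f q. p = (f 0 \<^bold>\<rightarrow> Com q) \<and>
        (\<forall>j. root (ds j) = (f j \<^bold>\<rightarrow> Everyone q \<^bold>\<and> Everyone (f (Suc j))))) \<and>
     (\<forall>j. omega_derivation (ds j))"

primrec assumptions :: "'i::finite deriv_tree \<Rightarrow> 'i fm set" where
  "assumptions (Leaf p) = (if S4C_axiom p then {} else {p})"
| "assumptions (MP p d e) = assumptions d \<union> assumptions e"
| "assumptions (Nec p d) = assumptions d"
| "assumptions (Omega p ds) = (\<Union>j. assumptions (ds j))"

definition derivable_global :: "'i::finite fm set \<Rightarrow> 'i fm \<Rightarrow> bool"  (infix \<open>\<turnstile>\<^sub>g\<close> 50) where
  "\<Sigma> \<turnstile>\<^sub>g p \<longleftrightarrow> (\<exists>d. omega_derivation d \<and> root d = p \<and> assumptions d \<subseteq> \<Sigma>)"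


section \<open>Algebraic semantics\<close>

text \<open>Algebras live on a carrier set, so that quantifying over the algebras with elements in a
  type also covers all algebras of smaller cardinality.\<close>

record ('a, 'i) s4c_alg =
  carr :: "'a set"
  meet :: "'a \<Rightarrow> 'a \<Rightarrow> 'a"  (infixl \<open>\<sqinter>\<index>\<close> 70)
  join :: "'a \<Rightarrow> 'a \<Rightarrow> 'a"  (infixl \<open>\<squnion>\<index>\<close> 65)
  compl :: "'a \<Rightarrow> 'a"
  zero :: 'a
  one :: 'a
  box :: "'i \<Rightarrow> 'a \<Rightarrow> 'a"
  com :: "'a \<Rightarrow> 'a"

definition le :: "('a, 'i) s4c_alg \<Rightarrow> 'a \<Rightarrow> 'a \<Rightarrow> bool"  (infix \<open>\<sqsubseteq>\<index>\<close> 50) where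
  "x \<sqsubseteq>\<^bsub>A\<^esub> y \<longleftrightarrow> x \<sqinter>\<^bsub>A\<^esub> y = x"

definition imp :: "('a, 'i) s4c_alg \<Rightarrow> 'a \<Rightarrow> 'a \<Rightarrow> 'a" where
  "imp A x y = compl A x \<squnion>\<^bsub>A\<^esub> y"

definition everyone :: "('a, 'i::finite) s4c_alg \<Rightarrow> 'a \<Rightarrow> 'a" where
  "everyone A x = foldr (\<lambda>i y. box A i x \<sqinter>\<^bsub>A\<^esub> y) index_list (one A)"

text \<open>The relativisation to a carrier of the library's \<^locale>\<open>abstract_boolean_algebra\<close>.\<close>

locale boolean_alg =
  fixes A :: "('a, 'i) s4c_alg" (structure)
  assumes meet_closed: "x \<in> carr A \<Longrightarrow> y \<in> carr A \<Longrightarrow> x \<sqinter> y \<in> carr A"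
    and join_closed: "x \<in> carr A \<Longrightarrow> y \<in> carr A \<Longrightarrow> x \<squnion> y \<in> carr A"
    and compl_closed: "x \<in> carr A \<Longrightarrow> compl A x \<in> carr A"
    and zero_closed: "zero A \<in> carr A"
    and one_closed: "one A \<in> carr A"
    and meet_assoc: "x \<in> carr A \<Longrightarrow> y \<in> carr A \<Longrightarrow> z \<in> carr A \<Longrightarrow>
          (x \<sqinter> y) \<sqinter> z = x \<sqinter> (y \<sqinter> z)"
    and meet_commute: "x \<in> carr A \<Longrightarrow> y \<in> carr A \<Longrightarrow> x \<sqinter> y = y \<sqinter> x"
    and join_assoc: "x \<in> carr A \<Longrightarrow> y \<in> carr A \<Longrightarrow> z \<in> carr A \<Longrightarrow>
          (x \<squnion> y) \<squnion> z = x \<squnion> (y \<squnion> z)"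
    and join_commute: "x \<in> carr A \<Longrightarrow> y \<in> carr A \<Longrightarrow> x \<squnion> y = y \<squnion> x"
    and meet_join_distrib: "x \<in> carr A \<Longrightarrow> y \<in> carr A \<Longrightarrow> z \<in> carr A \<Longrightarrow>
          x \<sqinter> (y \<squnion> z) = (x \<sqinter> y) \<squnion> (x \<sqinter> z)"
    and join_meet_distrib: "x \<in> carr A \<Longrightarrow> y \<in> carr A \<Longrightarrow> z \<in> carr A \<Longrightarrow>
          x \<squnion> (y \<sqinter> z) = (x \<squnion> y) \<sqinter> (x \<squnion> z)"
    and meet_one: "x \<in> carr A \<Longrightarrow> x \<sqinter> one A = x"
    and join_zero: "x \<in> carr A \<Longrightarrow> x \<squnion> zero A = x"
    and meet_compl: "x \<in> carr A \<Longrightarrow> x \<sqinter> compl A x = zero A"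
    and join_compl: "x \<in> carr A \<Longrightarrow> x \<squnion> compl A x = one A"

definition interior_operation :: "('a, 'i) s4c_alg \<Rightarrow> ('a \<Rightarrow> 'a) \<Rightarrow> bool" where
  "interior_operation A f \<longleftrightarrow>
     (\<forall>x\<in>carr A. f x \<in> carr A) \<and>
     f (one A) = one A \<and>
     (\<forall>x\<in>carr A. \<forall>y\<in>carr A. f (x \<sqinter>\<^bsub>A\<^esub> y) = f x \<sqinter>\<^bsub>A\<^esub> f y) \<and>
     (\<forall>x\<in>carr A. f x = f (f x)) \<and>
     (\<forall>x\<in>carr A. f x \<sqsubseteq>\<^bsub>A\<^esub> x)"

locale S4C_algebra = boolean_alg A for A :: "('a, 'i::finite) s4c_alg" (structure) +
  assumes box_interior: "interior_operation A (box A i)"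
    and com_interior: "interior_operation A (com A)"
    and com_le: "x \<in> carr A \<Longrightarrow> com A x \<sqsubseteq> everyone A x \<sqinter> everyone A (com A x)"
    and com_ind: "x \<in> carr A \<Longrightarrow>
          everyone A x \<sqinter> com A (imp A x (everyone A x)) \<sqsubseteq> com A x"

locale standard_S4C_algebra = S4C_algebra A for A :: "('a, 'i::finite) s4c_alg" (structure) +
  assumes standard: "d \<in> carr A \<Longrightarrow> (\<And>j. a j \<in> carr A) \<Longrightarrow>
    (\<And>j. a j \<sqsubseteq> everyone A d \<sqinter> everyone A (a (Suc j))) \<Longrightarrow> a (0::nat) \<sqsubseteq> com A d"

definition alg_valuation :: "('a, 'i) s4c_alg \<Rightarrow> ('i fm \<Rightarrow> 'a) \<Rightarrow> bool" where
  "alg_valuation A v \<longleftrightarrow>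
     (\<forall>p. v p \<in> carr A) \<and>
     v Fls = zero A \<and>
     (\<forall>p q. v (p \<^bold>\<rightarrow> q) = imp A (v p) (v q)) \<and>
     (\<forall>i p. v (Box i p) = box A i (v p)) \<and>
     (\<forall>p. v (Com p) = com A (v p))"

definition is_filter :: "('a, 'i) s4c_alg \<Rightarrow> 'a set \<Rightarrow> bool" where
  "is_filter A F \<longleftrightarrow>
     F \<subseteq> carr A \<and> one A \<in> F \<and>
     (\<forall>x\<in>F. \<forall>y\<in>F. x \<sqinter>\<^bsub>A\<^esub> y \<in> F) \<and>
     (\<forall>x\<in>F. \<forall>y\<in>carr A. x \<sqsubseteq>\<^bsub>A\<^esub> y \<longrightarrow> y \<in> F)"

definition generated_filter :: "('a, 'i) s4c_alg \<Rightarrow> 'a set \<Rightarrow> 'a set" where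
  "generated_filter A S = \<Inter>{F. is_filter A F \<and> S \<subseteq> F}"

text \<open>HOL cannot quantify over all types inside a formula, so the semantic consequence relations
  take as a parameter the type in which the algebras (below: the spaces) live. Over a small type
  such as \<^typ>\<open>unit\<close> they hold vacuously or too easily; over a type variable constrained only
  to be large enough, they cover the algebras (spaces) of every cardinality, since any of
  these has an isomorphic copy on a subset of a sufficiently large type.\<close>

definition alg_local :: "'a itself \<Rightarrow> 'i::finite fm set \<Rightarrow> 'i fm \<Rightarrow> bool" where
  "alg_local t \<Gamma> p \<longleftrightarrow>
     (\<forall>(A :: ('a, 'i) s4c_alg) v. standard_S4C_algebra A \<longrightarrow> alg_valuation A v \<longrightarrow>
        v p \<in> generated_filter A (v ` \<Gamma>))"

definition alg_global :: "'a itself \<Rightarrow> 'i::finite fm set \<Rightarrow> 'i fm \<Rightarrow> bool" where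
  "alg_global t \<Sigma> p \<longleftrightarrow>
     (\<forall>(A :: ('a, 'i) s4c_alg) v. standard_S4C_algebra A \<longrightarrow> alg_valuation A v \<longrightarrow>
        (\<forall>s\<in>\<Sigma>. v s = one A) \<longrightarrow> v p = one A)"


section \<open>Topological semantics\<close>

definition inter_topology :: "('i \<Rightarrow> 'x topology) \<Rightarrow> 'x topology" where
  "inter_topology T = topology (\<lambda>U. \<forall>i. openin (T i) U)"

lemma openin_inter_topology: "openin (inter_topology T) U \<longleftrightarrow> (\<forall>i. openin (T i) U)"
proof -
  have "istopology (\<lambda>U. \<forall>i. openin (T i) U)"
    by (auto simp: istopology_def)
  then show ?thesis
    by (simp add: inter_topology_def)
qed

definition topological_model ::
  "'x set \<Rightarrow> ('i \<Rightarrow> 'x topology) \<Rightarrow> ('i fm \<Rightarrow> 'x set) \<Rightarrow> bool" where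
  "topological_model X T v \<longleftrightarrow>
     (\<forall>i. topspace (T i) = X) \<and>
     (\<forall>p. v p \<subseteq> X) \<and>
     v Fls = {} \<and>
     (\<forall>p q. v (p \<^bold>\<rightarrow> q) = v q \<union> (X - v p)) \<and>
     (\<forall>i p. v (Box i p) = T i interior_of v p) \<and>
     (\<forall>p. v (Com p) = inter_topology T interior_of v p)"

definition top_local :: "'x itself \<Rightarrow> 'i::finite fm set \<Rightarrow> 'i fm \<Rightarrow> bool" where
  "top_local t \<Gamma> p \<longleftrightarrow>
     (\<forall>(X :: 'x set) T v. topological_model X T v \<longrightarrow>
        (\<forall>x\<in>X. (\<forall>q\<in>\<Gamma>. x \<in> v q) \<longrightarrow> x \<in> v p))"

definition top_global :: "'x itself \<Rightarrow> 'i::finite fm set \<Rightarrow> 'i fm \<Rightarrow> bool" where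
  "top_global t \<Sigma> p \<longleftrightarrow>
     (\<forall>(X :: 'x set) T v. topological_model X T v \<longrightarrow>
        (\<forall>s\<in>\<Sigma>. v s = X) \<longrightarrow> v p = X)"

end

theory Submission
  imports Defs "HOL-Library.Countable_Set"
begin

text \<open>
  Both chains of equivalences are proved as a cycle: derivability implies algebraic consequence,
  algebraic consequence implies topological consequence, and topological consequence implies
  derivability.

  \<^emph>\<open>Derivability implies algebraic consequence.\<close> Boolean reasoning inside an algebra is reduced to
  reasoning about membership in ultrafilters (\<open>le_iff_ultrafilter\<close>). The rule \<open>\<omega>\<close> is sound because
  standardness of an algebra is this rule, read for elements (\<open>derivable_global_sound\<close>).

  \<^emph>\<open>Algebraic consequence implies topological consequence.\<close> In a topological model, the sets that are
  values of formulas form an algebra, which is standard: if \<open>a\<^sub>j \<subseteq> E d \<inter> E a\<^sub>j\<^sub>+\<^sub>1\<close> for all \<open>j\<close>, then the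
  union of the \<open>a\<^sub>j\<close> is open in all the topologies and lies in \<open>d\<close>. As there are countably many
  formulas, this algebra is countable and has a copy inside any infinite type
  (\<open>valuation_range_embedding\<close>).

  \<^emph>\<open>Topological consequence implies derivability.\<close> Let \<open>L\<close> be a set of formulas that contains the axioms
  and is closed under modus ponens and necessitation. The points of the canonical model are the maximal
  \<open>L\<close>-consistent sets; a formula \<open>p\<close> determines the set \<open>hat p\<close> of the points that contain it. The topology
  of index \<open>i\<close> has as a base the sets \<open>hat c\<close> for which \<open>L\<close> contains the implication from \<open>c\<close> to \<open>Box i c\<close>.
  That the truth lemma holds for \<open>Box i\<close> is the argument of McKinsey and Tarski. For \<open>Com\<close> one has to show
  that a set \<open>U\<close> which is open in all the topologies and lies in \<open>hat p\<close> also lies in \<open>hat (Com p)\<close>. The set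
  \<open>U\<close> need not be of the form \<open>hat u\<close>, but since each \<open>hat a\<close> is compact, every \<open>hat a \<subseteq> U\<close> has some \<open>u\<close> with
  \<open>hat a \<subseteq> hat (E u)\<close> and \<open>hat u \<subseteq> U\<close>. Iterating this gives a sequence to which the rule \<open>\<omega>\<close> applies
  (\<open>interior_of_Com\<close>).

  It remains to see that both logics are closed under the rule \<open>\<omega>\<close>. For global derivability this is so by
  definition. For the theorems of the finitary calculus it is a form of the finite model property
  (\<open>omega_conservative\<close>): given a formula \<open>p\<close>, the base of the topologies is restricted to Boolean
  combinations of the finitely many modal subformulas and variables of \<open>p\<close>. Up to equivalence these are
  finitely many, so every sequence of them has a disjunction, and for such sequences the
  induction axiom for \<open>Com\<close> does the work of the rule \<open>\<omega>\<close> (\<open>omega_rule_finite\<close>). The resulting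
  topological model refutes \<open>p\<close> if \<open>p\<close> is not a theorem, whereas everything derivable with the rule \<open>\<omega>\<close>
  from no assumptions is valid in it.
\<close>

instance fm :: (finite) countable
  by countable_datatype

lemma prop_eval_big_conj: "prop_eval h (big_conj ps) \<longleftrightarrow> (\<forall>p\<in>set ps. prop_eval h p)"
  by (induction ps rule: big_conj.induct) auto

lemma prop_eval_Everyone: "prop_eval h (Everyone p) \<longleftrightarrow> (\<forall>i. h (Box i p))"
  by (simp add: Everyone_def prop_eval_big_conj index_list)

section \<open>Ultrafilters of a Boolean algebra\<close>

context boolean_alg
begin

lemmas closed = meet_closed join_closed compl_closed zero_closed one_closed

lemma meet_idem: "x \<in> carr A \<Longrightarrow> x \<sqinter> x = x"
  by (metis closed join_compl join_zero meet_compl meet_join_distrib meet_one)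

lemma meet_zero: "x \<in> carr A \<Longrightarrow> x \<sqinter> zero A = zero A"
  by (metis closed meet_assoc meet_compl meet_idem)

lemma meet_join_absorb:
  assumes "x \<in> carr A" "y \<in> carr A"
  shows "x \<sqinter> (x \<squnion> y) = x"
proof -
  have "x \<sqinter> (x \<squnion> y) = (x \<squnion> zero A) \<sqinter> (x \<squnion> y)"
    by (simp add: assms join_zero)
  also have "\<dots> = x \<squnion> (zero A \<sqinter> y)"
    by (simp add: assms closed join_meet_distrib)
  finally show ?thesis
    by (simp add: assms closed meet_commute[of "zero A"] meet_zero join_zero)
qed

lemma le_trans: "x \<sqsubseteq> y \<Longrightarrow> y \<sqsubseteq> z \<Longrightarrow> x \<in> carr A \<Longrightarrow> y \<in> carr A \<Longrightarrow> z \<in> carr A \<Longrightarrow> x \<sqsubseteq> z"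
  by (metis le_def meet_assoc)

lemma meet_le1: "x \<in> carr A \<Longrightarrow> y \<in> carr A \<Longrightarrow> x \<sqinter> y \<sqsubseteq> x"
  by (metis le_def meet_assoc meet_commute meet_idem)

lemma meet_le2: "x \<in> carr A \<Longrightarrow> y \<in> carr A \<Longrightarrow> x \<sqinter> y \<sqsubseteq> y"
  by (metis meet_le1 meet_commute)

lemma le_meet: "x \<in> carr A \<Longrightarrow> y \<in> carr A \<Longrightarrow> z \<in> carr A \<Longrightarrow> z \<sqsubseteq> x \<Longrightarrow> z \<sqsubseteq> y \<Longrightarrow> z \<sqsubseteq> x \<sqinter> y"
  by (metis le_def meet_assoc)

lemma meet_le_meet:
  assumes "x \<in> carr A" "y \<in> carr A" "z \<in> carr A" "x \<sqsubseteq> z"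
  shows "x \<sqinter> y \<sqsubseteq> z \<sqinter> y"
proof (rule le_meet)
  show "x \<sqinter> y \<sqsubseteq> z"
    using le_trans[OF meet_le1[OF assms(1,2)] assms(4)] assms meet_closed by simp
qed (use assms meet_le2 meet_closed in auto)

text \<open>In a distributive lattice with complements, \<open>y\<close> is the join of its parts inside and outside \<open>x\<close>. This is the
  step that makes a filter maximal among those avoiding \<open>b\<close> decide every element.\<close>

lemma le_cases:
  assumes c: "x \<in> carr A" "y \<in> carr A" "b \<in> carr A"
    and "y \<sqinter> x \<sqsubseteq> b" "y \<sqinter> compl A x \<sqsubseteq> b"
  shows "y \<sqsubseteq> b"
proof -
  have "b \<sqinter> y = b \<sqinter> (y \<sqinter> (x \<squnion> compl A x))"
    by (simp add: c join_compl meet_one)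
  also have "\<dots> = (b \<sqinter> (y \<sqinter> x)) \<squnion> (b \<sqinter> (y \<sqinter> compl A x))"
    by (simp add: c closed meet_join_distrib)
  also have "\<dots> = (y \<sqinter> x) \<squnion> (y \<sqinter> compl A x)"
    using assms by (simp add: le_def closed meet_commute[of b])
  also have "\<dots> = y"
    by (metis c(1,2) closed(3) join_compl meet_join_distrib meet_one)
  finally show ?thesis
    by (simp add: le_def c meet_commute)
qed

definition ultrafilter :: "'a set \<Rightarrow> bool" where
  "ultrafilter U \<longleftrightarrow> is_filter A U \<and> (\<forall>x\<in>carr A. x \<in> U \<longleftrightarrow> compl A x \<notin> U)"

lemma ultrafilter_compl: "ultrafilter U \<Longrightarrow> x \<in> carr A \<Longrightarrow> compl A x \<in> U \<longleftrightarrow> x \<notin> U"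
  by (auto simp: ultrafilter_def)

lemma ultrafilter_one: "ultrafilter U \<Longrightarrow> one A \<in> U"
  by (auto simp: ultrafilter_def is_filter_def)

lemma ultrafilter_zero: "ultrafilter U \<Longrightarrow> zero A \<notin> U"
  by (metis closed(3,5) meet_commute meet_compl meet_one ultrafilter_compl ultrafilter_one)

lemma ultrafilter_le: "ultrafilter U \<Longrightarrow> x \<sqsubseteq> y \<Longrightarrow> x \<in> U \<Longrightarrow> y \<in> carr A \<Longrightarrow> y \<in> U"
  by (auto simp: ultrafilter_def is_filter_def)

lemma ultrafilter_meet:
  assumes "ultrafilter U" "x \<in> carr A" "y \<in> carr A"
  shows "x \<sqinter> y \<in> U \<longleftrightarrow> x \<in> U \<and> y \<in> U"
proof
  show "x \<in> U \<and> y \<in> U" if "x \<sqinter> y \<in> U"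
    using ultrafilter_le[OF assms(1) meet_le1 that] ultrafilter_le[OF assms(1) meet_le2 that] assms(2,3)
    by simp
  show "x \<sqinter> y \<in> U" if "x \<in> U \<and> y \<in> U"
    using assms(1) that by (simp add: ultrafilter_def is_filter_def)
qed

lemma ultrafilter_join:
  assumes U: "ultrafilter U" and c: "x \<in> carr A" "y \<in> carr A"
  shows "x \<squnion> y \<in> U \<longleftrightarrow> x \<in> U \<or> y \<in> U"
proof
  assume xy: "x \<squnion> y \<in> U"
  show "x \<in> U \<or> y \<in> U"
  proof (rule ccontr)
    assume n: "\<not> (x \<in> U \<or> y \<in> U)"
    let ?n = "compl A x \<sqinter> compl A y"
    have "?n \<sqinter> (x \<squnion> y) \<in> U"
      using n xy U c by (simp add: ultrafilter_meet ultrafilter_compl closed)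
    then have "(?n \<sqinter> x) \<squnion> (?n \<sqinter> y) \<in> U"
      using c by (simp add: meet_join_distrib closed)
    moreover have "?n \<sqinter> x = zero A"
      by (metis c closed(3) meet_assoc meet_commute meet_compl meet_zero)
    moreover have "?n \<sqinter> y = zero A"
      by (metis c closed(3) meet_assoc meet_commute meet_compl meet_zero)
    ultimately show False
      using U by (simp add: closed join_zero ultrafilter_zero)
  qed
next
  assume "x \<in> U \<or> y \<in> U"
  moreover have "x \<sqsubseteq> x \<squnion> y" "y \<sqsubseteq> x \<squnion> y"
    using c meet_join_absorb[of x y] meet_join_absorb[of y x] by (auto simp: le_def join_commute)
  ultimately show "x \<squnion> y \<in> U"
    using ultrafilter_le[OF U] c closed(2) by blast
qed

lemma ultrafilter_imp:
  assumes "ultrafilter U" "x \<in> carr A" "y \<in> carr A"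
  shows "imp A x y \<in> U \<longleftrightarrow> (x \<in> U \<longrightarrow> y \<in> U)"
  using assms by (simp add: imp_def ultrafilter_join ultrafilter_compl closed)

lemma is_filter_adjoin:
  assumes F: "is_filter A F" and x: "x \<in> carr A"
  shows "is_filter A {y \<in> carr A. \<exists>u\<in>F. u \<sqinter> x \<sqsubseteq> y}" (is "is_filter A ?G")
proof -
  have Fc: "F \<subseteq> carr A" "one A \<in> F" and Fm: "\<And>u w. u \<in> F \<Longrightarrow> w \<in> F \<Longrightarrow> u \<sqinter> w \<in> F"
    using F by (auto simp: is_filter_def)
  have "one A \<in> ?G"
    using Fc x closed(1,5) by (auto simp: le_def meet_one intro!: bexI[of _ "one A"])
  moreover have "y \<sqinter> z \<in> ?G" if y: "y \<in> ?G" and z: "z \<in> ?G" for y z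
  proof -
    obtain u w where u: "u \<in> F" "u \<sqinter> x \<sqsubseteq> y" and w: "w \<in> F" "w \<sqinter> x \<sqsubseteq> z"
      using y z by auto
    have c: "u \<in> carr A" "w \<in> carr A" "y \<in> carr A" "z \<in> carr A"
      using u w Fc y z by auto
    have "(u \<sqinter> w) \<sqinter> x \<sqsubseteq> u \<sqinter> x" "(u \<sqinter> w) \<sqinter> x \<sqsubseteq> w \<sqinter> x"
      using c x by (simp_all add: closed meet_le_meet meet_le1 meet_le2)
    then have "(u \<sqinter> w) \<sqinter> x \<sqsubseteq> y" "(u \<sqinter> w) \<sqinter> x \<sqsubseteq> z"
      using le_trans[OF _ u(2)] le_trans[OF _ w(2)] c x by (simp_all add: closed)
    then have "(u \<sqinter> w) \<sqinter> x \<sqsubseteq> y \<sqinter> z"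
      using c x by (simp add: closed le_meet)
    then show ?thesis
      using Fm[OF u(1) w(1)] c by (auto simp: closed)
  qed
  moreover have "z \<in> ?G" if y: "y \<in> ?G" and z: "z \<in> carr A" "y \<sqsubseteq> z" for y z
  proof -
    obtain u where "u \<in> F" "u \<sqinter> x \<sqsubseteq> y" "u \<in> carr A" "y \<in> carr A"
      using y Fc by auto
    then show ?thesis
      using le_trans[of "u \<sqinter> x" y z] z x closed(1) by auto
  qed
  ultimately show ?thesis
    by (auto simp: is_filter_def)
qed

text \<open>By the lemma of Zorn there is a maximal filter that contains \<open>a\<close> and avoids \<open>b\<close>. If it decided neither \<open>x\<close> nor its
  complement, then adjoining either of them would put \<open>b\<close> into the filter, so \<open>b\<close> would lie above some
  \<open>u \<sqinter> x\<close> and some \<open>w \<sqinter> compl x\<close> with \<open>u\<close> and \<open>w\<close> in the filter, and hence above \<open>u \<sqinter> w\<close>.\<close>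

lemma ultrafilter_separation:
  assumes a: "a \<in> carr A" and b: "b \<in> carr A" and nle: "\<not> a \<sqsubseteq> b"
  shows "\<exists>U. ultrafilter U \<and> a \<in> U \<and> b \<notin> U"
proof -
  let ?S = "{F. is_filter A F \<and> a \<in> F \<and> b \<notin> F}"
  have "is_filter A (carr A \<inter> {y. a \<sqsubseteq> y})"
    using a closed(1,5) le_trans[of a] le_meet[of _ _ a] unfolding is_filter_def
    by (auto simp: meet_one le_def[of A a "one A"])
  then have "carr A \<inter> {y. a \<sqsubseteq> y} \<in> ?S"
    using a nle meet_idem by (auto simp: le_def)
  then have ne: "?S \<noteq> {}"
    by blast
  have "\<Union>\<C> \<in> ?S" if "\<C> \<noteq> {}" "subset.chain ?S \<C>" for \<C>
  proof -
    have S: "\<And>F. F \<in> \<C> \<Longrightarrow> F \<in> ?S"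
      and tot: "\<And>F G. F \<in> \<C> \<Longrightarrow> G \<in> \<C> \<Longrightarrow> F \<subseteq> G \<or> G \<subseteq> F"
      using that(2) by (auto simp: subset.chain_def)
    have m: "x \<sqinter> y \<in> \<Union>\<C>" if xy: "x \<in> \<Union>\<C>" "y \<in> \<Union>\<C>" for x y
    proof -
      obtain F where "F \<in> \<C>" "x \<in> F" "y \<in> F"
        using xy tot by blast
      then show ?thesis
        using S unfolding is_filter_def by blast
    qed
    have F: "is_filter A F" "a \<in> F" "b \<notin> F" if "F \<in> \<C>" for F
      using S[OF that] by auto
    have "is_filter A (\<Union>\<C>)"
      unfolding is_filter_def
    proof (intro conjI ballI impI)
      show "\<Union>\<C> \<subseteq> carr A" "one A \<in> \<Union>\<C>"
        using F(1) that(1) by (fastforce simp: is_filter_def)+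
      show "x \<sqinter> y \<in> \<Union>\<C>" if "x \<in> \<Union>\<C>" "y \<in> \<Union>\<C>" for x y
        using m that .
      show "y \<in> \<Union>\<C>" if "x \<in> \<Union>\<C>" "y \<in> carr A" "x \<sqsubseteq> y" for x y
        using that F(1) unfolding is_filter_def by (meson UnionE UnionI)
    qed
    moreover have "a \<in> \<Union>\<C>" "b \<notin> \<Union>\<C>"
      using F that(1) by auto
    ultimately show ?thesis
      by blast
  qed
  from subset_Zorn_nonempty[OF ne this] obtain U
    where U: "is_filter A U" "a \<in> U" "b \<notin> U"
      and max: "\<And>F. F \<in> ?S \<Longrightarrow> U \<subseteq> F \<Longrightarrow> F = U"
    by auto
  have Uc: "U \<subseteq> carr A" and Um: "\<And>u w. u \<in> U \<Longrightarrow> w \<in> U \<Longrightarrow> u \<sqinter> w \<in> U"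
    and Ule: "\<And>x y. x \<in> U \<Longrightarrow> x \<sqsubseteq> y \<Longrightarrow> y \<in> carr A \<Longrightarrow> y \<in> U" and U1: "one A \<in> U"
    using U(1) by (auto simp: is_filter_def)
  have ext: "\<exists>u\<in>U. u \<sqinter> x \<sqsubseteq> b" if x: "x \<in> carr A" "x \<notin> U" for x
  proof (rule ccontr)
    assume n: "\<not> (\<exists>u\<in>U. u \<sqinter> x \<sqsubseteq> b)"
    let ?G = "{y \<in> carr A. \<exists>u\<in>U. u \<sqinter> x \<sqsubseteq> y}"
    have "U \<subseteq> ?G"
      using Uc meet_le1 x(1) by blast
    moreover have "x \<in> ?G"
      using U1 x(1) closed(5) meet_le2 by blast
    ultimately show False
      using max[of ?G] is_filter_adjoin[OF U(1) x(1)] U(2) n x(2) by blast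
  qed
  have "x \<in> U \<or> compl A x \<in> U" if x: "x \<in> carr A" for x
  proof (rule ccontr)
    assume "\<not> (x \<in> U \<or> compl A x \<in> U)"
    then obtain u w where u: "u \<in> U" "u \<sqinter> x \<sqsubseteq> b" and w: "w \<in> U" "w \<sqinter> compl A x \<sqsubseteq> b"
      using ext x closed(3) by metis
    have c: "u \<in> carr A" "w \<in> carr A"
      using u w Uc by auto
    have "(u \<sqinter> w) \<sqinter> x \<sqsubseteq> u \<sqinter> x" "(u \<sqinter> w) \<sqinter> compl A x \<sqsubseteq> w \<sqinter> compl A x"
      using c x by (simp_all add: closed meet_le_meet meet_le1 meet_le2)
    then have "(u \<sqinter> w) \<sqinter> x \<sqsubseteq> b" "(u \<sqinter> w) \<sqinter> compl A x \<sqsubseteq> b"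
      using le_trans[OF _ u(2)] le_trans[OF _ w(2)] c x b by (simp_all add: closed)
    then have "u \<sqinter> w \<sqsubseteq> b"
      using le_cases[of x "u \<sqinter> w" b] c x b closed(1) by blast
    then show False
      using Ule[OF Um[OF u(1) w(1)]] b U(3) by blast
  qed
  moreover have "\<not> (x \<in> U \<and> compl A x \<in> U)" if "x \<in> carr A" for x
    by (metis Ule Um U(3) b that closed(4) le_def meet_commute meet_compl meet_zero)
  ultimately show ?thesis
    using U unfolding ultrafilter_def by blast
qed

text \<open>Membership in an ultrafilter commutes with the Boolean operations. So the next equivalences turn
  every Boolean inequality and equation into a propositional statement about memberships.\<close>

lemma le_iff_ultrafilter:
  "x \<in> carr A \<Longrightarrow> y \<in> carr A \<Longrightarrow> x \<sqsubseteq> y \<longleftrightarrow> (\<forall>U. ultrafilter U \<longrightarrow> x \<in> U \<longrightarrow> y \<in> U)"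
  using ultrafilter_separation[of x y] ultrafilter_le[of _ x y] by metis

lemma eq_iff_ultrafilter:
  assumes "x \<in> carr A" "y \<in> carr A"
  shows "x = y \<longleftrightarrow> (\<forall>U. ultrafilter U \<longrightarrow> x \<in> U \<longleftrightarrow> y \<in> U)"
proof -
  have "x = y \<longleftrightarrow> x \<sqsubseteq> y \<and> y \<sqsubseteq> x"
    using assms by (metis le_def meet_commute meet_idem)
  then show ?thesis
    using le_iff_ultrafilter[OF assms] le_iff_ultrafilter[OF assms(2,1)] by auto
qed

lemma eq_one_iff_ultrafilter:
  "x \<in> carr A \<Longrightarrow> x = one A \<longleftrightarrow> (\<forall>U. ultrafilter U \<longrightarrow> x \<in> U)"
  using eq_iff_ultrafilter[OF _ closed(5)] ultrafilter_one by blast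

lemma imp_closed: "x \<in> carr A \<Longrightarrow> y \<in> carr A \<Longrightarrow> imp A x y \<in> carr A"
  by (simp add: imp_def closed)

lemma imp_eq_one_iff:
  assumes "x \<in> carr A" "y \<in> carr A"
  shows "imp A x y = one A \<longleftrightarrow> x \<sqsubseteq> y"
  using assms by (simp add: eq_one_iff_ultrafilter le_iff_ultrafilter imp_closed ultrafilter_imp)

end

section \<open>Soundness in algebras\<close>

context S4C_algebra
begin

lemma interior_op:
  assumes "interior_operation A f"
  shows interior_op_closed: "x \<in> carr A \<Longrightarrow> f x \<in> carr A"
    and interior_op_one: "f (one A) = one A"
    and interior_op_meet: "x \<in> carr A \<Longrightarrow> y \<in> carr A \<Longrightarrow> f (x \<sqinter> y) = f x \<sqinter> f y"
    and interior_op_idem: "x \<in> carr A \<Longrightarrow> f (f x) = f x"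
    and interior_op_le: "x \<in> carr A \<Longrightarrow> f x \<sqsubseteq> x"
  using assms by (simp_all add: interior_operation_def)

lemma interior_op_mono:
  "interior_operation A f \<Longrightarrow> x \<in> carr A \<Longrightarrow> y \<in> carr A \<Longrightarrow> x \<sqsubseteq> y \<Longrightarrow> f x \<sqsubseteq> f y"
  using interior_op_meet[of f x y] by (simp add: le_def)

lemma interior_op_imp:
  assumes f: "interior_operation A f" and c: "x \<in> carr A" "y \<in> carr A"
    and U: "ultrafilter U" "f (imp A x y) \<in> U" "f x \<in> U"
  shows "f y \<in> U"
proof -
  have ic: "imp A x y \<in> carr A"
    using c by (rule imp_closed)
  have "imp A x y \<sqinter> x \<sqsubseteq> y"
    using c ic by (simp add: le_iff_ultrafilter closed ultrafilter_meet ultrafilter_imp)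
  then have "f (imp A x y \<sqinter> x) \<sqsubseteq> f y"
    using interior_op_mono[OF f] c ic closed(1) by blast
  moreover have "f (imp A x y \<sqinter> x) = f (imp A x y) \<sqinter> f x"
    using c ic by (simp add: interior_op_meet[OF f])
  ultimately have "f (imp A x y) \<sqinter> f x \<sqsubseteq> f y"
    by simp
  then show ?thesis
    using U c ic interior_op_closed[OF f] by (metis ultrafilter_le ultrafilter_meet)
qed

lemma box_closed: "x \<in> carr A \<Longrightarrow> box A i x \<in> carr A"
  by (rule interior_op_closed[OF box_interior])

lemma com_closed: "x \<in> carr A \<Longrightarrow> com A x \<in> carr A"
  by (rule interior_op_closed[OF com_interior])

lemma everyone_closed_ultrafilter:
  assumes "x \<in> carr A"
  shows everyone_closed: "everyone A x \<in> carr A"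
    and ultrafilter_everyone: "ultrafilter U \<Longrightarrow> everyone A x \<in> U \<longleftrightarrow> (\<forall>i. box A i x \<in> U)"
proof -
  let ?m = "\<lambda>is. foldr (\<lambda>i y. box A i x \<sqinter> y) is (one A)"
  have c: "?m is \<in> carr A" for "is"
    by (induction "is") (auto simp: assms closed box_closed)
  have u: "?m is \<in> U \<longleftrightarrow> (\<forall>i\<in>set is. box A i x \<in> U)" if "ultrafilter U" for U "is"
    using that by (induction "is") (auto simp: assms ultrafilter_one ultrafilter_meet box_closed c)
  show "everyone A x \<in> carr A"
    using c by (simp add: everyone_def)
  show "ultrafilter U \<Longrightarrow> everyone A x \<in> U \<longleftrightarrow> (\<forall>i. box A i x \<in> U)"
    using u[of U index_list] by (simp add: everyone_def index_list)
qed

text \<open>An ultrafilter makes a valuation two-valued; this is why tautologies take the value one.\<close>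

lemma ultrafilter_eval:
  assumes "alg_valuation A v" "ultrafilter U"
  shows "prop_eval (\<lambda>q. v q \<in> U) p \<longleftrightarrow> v p \<in> U"
  using assms
  by (induction p)
    (auto simp: alg_valuation_def ultrafilter_zero ultrafilter_imp)

lemma valuation_Everyone:
  assumes "alg_valuation A v"
  shows "v (Everyone p) = everyone A (v p)"
  using assms ultrafilter_eval[OF assms, of _ "Everyone p"]
  by (subst eq_iff_ultrafilter)
    (auto simp: prop_eval_Everyone ultrafilter_everyone everyone_closed alg_valuation_def)

lemma valuation_Conj:
  assumes "alg_valuation A v"
  shows "v (p \<^bold>\<and> q) = v p \<sqinter> v q"
proof -
  have c: "v r \<in> carr A" for r
    using assms by (simp add: alg_valuation_def)
  have "v (p \<^bold>\<and> q) \<in> U \<longleftrightarrow> v p \<in> U \<and> v q \<in> U" if "ultrafilter U" for U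
    using ultrafilter_eval[OF assms that] prop_eval.simps by metis
  then show ?thesis
    using eq_iff_ultrafilter[OF c, of "v p \<sqinter> v q"] by (simp add: c closed ultrafilter_meet)
qed

lemma valuation_axiom:
  assumes v: "alg_valuation A v" and "S4C_axiom p"
  shows "v p = one A"
proof -
  have vc: "v q \<in> carr A" for q
    using v by (simp add: alg_valuation_def)
  have vbox: "v (Box i q) = box A i (v q)" and vcom: "v (Com q) = com A (v q)"
    and vimp: "v (q \<^bold>\<rightarrow> r) = imp A (v q) (v r)" for i q r
    using v by (simp_all add: alg_valuation_def)
  have "v p \<in> U" if U: "ultrafilter U" for U
  proof -
    have imp: "v (q \<^bold>\<rightarrow> r) \<in> U \<longleftrightarrow> (v q \<in> U \<longrightarrow> v r \<in> U)" for q r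
      using U vc by (simp add: ultrafilter_imp vimp)
    from \<open>S4C_axiom p\<close> show ?thesis
    proof cases
      case taut
      then show ?thesis
        using ultrafilter_eval[OF v U, of p] unfolding tautology_def by blast
    next
      case (box_K i q r)
      then show ?thesis
        using interior_op_imp[OF box_interior vc vc U, of i q r] by (simp add: imp vbox flip: vimp)
    next
      case (box_4 i q)
      then show ?thesis
        using interior_op_idem[OF box_interior vc] by (simp add: imp vbox)
    next
      case (box_T i q)
      then show ?thesis
        using ultrafilter_le[OF U interior_op_le[OF box_interior vc] _ vc, of i q] by (simp add: imp vbox)
    next
      case (com_K q r)
      then show ?thesis
        using interior_op_imp[OF com_interior vc vc U, of q r] by (simp add: imp vcom flip: vimp)
    next
      case (com_unfold q)
      show ?thesis
        using ultrafilter_le[OF U com_le[OF vc[of q]]] U vc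
        by (simp add: com_unfold imp valuation_Conj[OF v] valuation_Everyone[OF v] vcom meet_closed ultrafilter_meet everyone_closed com_closed)
    next
      case (com_induct q)
      show ?thesis
        using ultrafilter_le[OF U com_ind[OF vc[of q]]] U vc
        by (simp add: com_induct imp valuation_Conj[OF v] vcom ultrafilter_meet com_closed
            flip: valuation_Everyone[OF v] vimp)
    qed
  qed
  then show ?thesis
    using vc eq_one_iff_ultrafilter by blast
qed

lemma valuation_theorem: 
  assumes v: "alg_valuation A v" and "S4C_theorem p"
  shows "v p = one A"
  using assms(2)
proof induction
  case (ax p)
  then show ?case
    by (simp add: valuation_axiom v)
next
  case (mp p q)
  have c: "v p \<in> carr A" "v q \<in> carr A"
    using v by (simp_all add: alg_valuation_def)
  have "one A \<sqsubseteq> v q"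
    using v mp.IH imp_eq_one_iff[OF c] by (simp add: alg_valuation_def)
  then show ?case
    using meet_one[OF c(2)] meet_commute[OF c(2) closed(5)] by (simp add: le_def)
next
  case (nec p)
  then show ?case
    using v interior_op_one[OF com_interior] by (simp add: alg_valuation_def)
qed

text \<open>Any filter that contains the values of \<open>\<Gamma>\<close> contains the value of each finite conjunction of formulas
  in \<open>\<Gamma>\<close>, and the value of \<open>p\<close> lies above the value of one such conjunction.\<close>

lemma derivable_local_sound:
  assumes v: "alg_valuation A v" and "\<Gamma> \<turnstile>\<^sub>l p"
  shows "v p \<in> generated_filter A (v ` \<Gamma>)"
proof -
  have vc: "v q \<in> carr A" for q
    using v by (simp add: alg_valuation_def)
  obtain ps where ps: "set ps \<subseteq> \<Gamma>" "S4C_theorem (big_conj ps \<^bold>\<rightarrow> p)"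
    using assms(2) by (auto simp: derivable_local_def)
  have "v (big_conj ps \<^bold>\<rightarrow> p) = one A"
    using valuation_theorem[OF v ps(2)] .
  then have le: "v (big_conj ps) \<sqsubseteq> v p"
    using v imp_eq_one_iff[OF vc vc] by (simp add: alg_valuation_def)
  have "v p \<in> F" if F: "is_filter A F" "v ` \<Gamma> \<subseteq> F" for F
  proof -
    have "v (big_conj ps) \<in> F"
      using ps(1)
    proof (induction ps rule: big_conj.induct)
      case 1
      have "v Tru = one A"
        using valuation_axiom[OF v] S4C_axiom.taut[of Tru] by (simp add: tautology_def)
      then show ?case
        using F(1) by (simp add: is_filter_def)
    next
      case (2 q)
      then show ?case
        using F(2) by auto
    next
      case (3 q r qs)
      then have "v q \<in> F" "v (big_conj (r # qs)) \<in> F"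
        using F(2) by auto
      then show ?case
        using F(1) valuation_Conj[OF v] by (simp add: is_filter_def)
    qed
    then show ?thesis
      using F(1) le vc unfolding is_filter_def by blast
  qed
  then show ?thesis
    by (simp add: generated_filter_def)
qed

end

text \<open>Induction on the derivation. At a node where the rule \<open>\<omega>\<close> is applied, the sequence of the values of the \<open>f j\<close>
  meets the hypothesis of standardness.\<close>

lemma (in standard_S4C_algebra) derivable_global_sound:
  assumes v: "alg_valuation A v" and s: "\<And>s. s \<in> \<Sigma> \<Longrightarrow> v s = one A" and "\<Sigma> \<turnstile>\<^sub>g p"
  shows "v p = one A"
proof -
  have vc: "v q \<in> carr A" for q
    using v by (simp add: alg_valuation_def)
  have vimp: "v (q \<^bold>\<rightarrow> r) = one A \<longleftrightarrow> v q \<sqsubseteq> v r" for q r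
    using v imp_eq_one_iff[OF vc vc] by (simp add: alg_valuation_def)
  have "v (root d) = one A" if "omega_derivation d" "assumptions d \<subseteq> \<Sigma>" for d
    using that
  proof (induction d)
    case (Leaf q)
    then show ?case
      using s valuation_axiom[OF v] by (auto split: if_splits)
  next
    case (MP q d e)
    then have "v (root d) = one A" "v (root d \<^bold>\<rightarrow> q) = one A"
      by auto
    then have "one A \<sqsubseteq> v q"
      by (simp add: vimp)
    then show ?case
      using meet_one[OF vc] meet_commute[OF vc closed(5)] by (simp add: le_def)
  next
    case (Nec q d)
    then show ?case
      using v interior_op_one[OF com_interior] by (simp add: alg_valuation_def)
  next
    case (Omega q ds)
    then obtain f r where q: "q = (f 0 \<^bold>\<rightarrow> Com r)"
      and f: "\<And>j. root (ds j) = (f j \<^bold>\<rightarrow> Everyone r \<^bold>\<and> Everyone (f (Suc j)))"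
      by auto
    have "v (root (ds j)) = one A" for j
      using Omega by auto
    then have "v (f j) \<sqsubseteq> everyone A (v r) \<sqinter> everyone A (v (f (Suc j)))" for j
      unfolding f vimp by (simp add: valuation_Conj[OF v] valuation_Everyone[OF v])
    then have "v (f 0) \<sqsubseteq> com A (v r)"
      using standard[of "v r" "\<lambda>j. v (f j)"] vc by simp
    then show ?case
      using v by (simp add: q vimp) (simp add: alg_valuation_def)
  qed
  then show ?thesis
    using assms(3) by (auto simp: derivable_global_def)
qed

section \<open>Algebras of subsets of a topological model\<close>

text \<open>A family \<open>R\<close> of subsets of a space that is closed under the operations of its power set algebra, together
  with an injective renaming \<open>e\<close> of its members. The renaming moves the algebra into a type that may be much smaller
  than the type of all subsets.\<close>

locale subset_algebra =
  fixes X :: "'x set" and T :: "'i::finite \<Rightarrow> 'x topology" and R :: "'x set set" and e :: "'x set \<Rightarrow> 'a"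
  assumes topspace_X: "topspace (T i) = X"
    and R_subset: "Y \<in> R \<Longrightarrow> Y \<subseteq> X"
    and R_empty: "{} \<in> R"
    and R_Diff: "Y \<in> R \<Longrightarrow> X - Y \<in> R"
    and R_Un: "Y \<in> R \<Longrightarrow> Z \<in> R \<Longrightarrow> Y \<union> Z \<in> R"
    and R_interior: "Y \<in> R \<Longrightarrow> T i interior_of Y \<in> R"
    and R_inter_interior: "Y \<in> R \<Longrightarrow> inter_topology T interior_of Y \<in> R"
    and inj_e: "inj_on e R"
begin

definition dec :: "'a \<Rightarrow> 'x set" where
  "dec = inv_into R e"

definition alg :: "('a, 'i) s4c_alg" where
  "alg = \<lparr>carr = e ` R,
     meet = \<lambda>a b. e (dec a \<inter> dec b),
     join = \<lambda>a b. e (dec a \<union> dec b),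
     compl = \<lambda>a. e (X - dec a),
     zero = e {},
     one = e X,
     box = \<lambda>i a. e (T i interior_of dec a),
     com = \<lambda>a. e (inter_topology T interior_of dec a)\<rparr>"

lemma dec_e [simp]: "Y \<in> R \<Longrightarrow> dec (e Y) = Y"
  by (simp add: dec_def inj_e)

lemma e_eq_iff: "Y \<in> R \<Longrightarrow> Z \<in> R \<Longrightarrow> e Y = e Z \<longleftrightarrow> Y = Z"
  using inj_e by (auto simp: inj_on_def)

lemma R_X [simp]: "X \<in> R"
  using R_Diff[OF R_empty] by simp

lemma R_Int [simp]:
  assumes "Y \<in> R" "Z \<in> R"
  shows "Y \<inter> Z \<in> R"
proof -
  have "Y \<inter> Z = X - ((X - Y) \<union> (X - Z))"
    using assms R_subset by blast
  then show ?thesis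
    using assms by (simp add: R_Diff R_Un)
qed

lemmas R_closed [simp] = R_empty R_Diff R_Un R_interior R_inter_interior

lemma alg_simps [simp]:
  "carr alg = e ` R"
  "zero alg = e {}"
  "one alg = e X"
  "Y \<in> R \<Longrightarrow> Z \<in> R \<Longrightarrow> e Y \<sqinter>\<^bsub>alg\<^esub> e Z = e (Y \<inter> Z)"
  "Y \<in> R \<Longrightarrow> Z \<in> R \<Longrightarrow> e Y \<squnion>\<^bsub>alg\<^esub> e Z = e (Y \<union> Z)"
  "Y \<in> R \<Longrightarrow> compl alg (e Y) = e (X - Y)"
  "Y \<in> R \<Longrightarrow> box alg i (e Y) = e (T i interior_of Y)"
  "Y \<in> R \<Longrightarrow> com alg (e Y) = e (inter_topology T interior_of Y)"
  by (simp_all add: alg_def)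

lemma le_alg [simp]: "Y \<in> R \<Longrightarrow> Z \<in> R \<Longrightarrow> e Y \<sqsubseteq>\<^bsub>alg\<^esub> e Z \<longleftrightarrow> Y \<subseteq> Z"
  by (auto simp: le_def e_eq_iff)

lemma imp_alg [simp]: "Y \<in> R \<Longrightarrow> Z \<in> R \<Longrightarrow> imp alg (e Y) (e Z) = e (Z \<union> (X - Y))"
  by (simp add: imp_def Un_commute)

lemma everyone_alg:
  assumes Y: "Y \<in> R"
  shows R_everyone [simp]: "X \<inter> (\<Inter>i. T i interior_of Y) \<in> R"
    and everyone_alg_eq [simp]: "everyone alg (e Y) = e (X \<inter> (\<Inter>i. T i interior_of Y))"
proof -
  have "X \<inter> (\<Inter>i\<in>set is. T i interior_of Y) \<in> R \<and>
      foldr (\<lambda>i y. box alg i (e Y) \<sqinter>\<^bsub>alg\<^esub> y) is (e X) = e (X \<inter> (\<Inter>i\<in>set is. T i interior_of Y))"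
    for "is"
  proof (induction "is")
    case (Cons i "is")
    have "X \<inter> (\<Inter>j\<in>set (i # is). T j interior_of Y)
        = T i interior_of Y \<inter> (X \<inter> (\<Inter>j\<in>set is. T j interior_of Y))"
      by auto
    then show ?case
      using Cons Y by simp
  qed simp
  from this[of index_list]
  show "X \<inter> (\<Inter>i. T i interior_of Y) \<in> R"
    and "everyone alg (e Y) = e (X \<inter> (\<Inter>i. T i interior_of Y))"
    by (simp_all add: everyone_def index_list)
qed

lemma topspace_inter_topology: "topspace (inter_topology T) = X"
proof -
  have "openin (inter_topology T) X"
    using topspace_X openin_topspace by (metis openin_inter_topology)
  then show ?thesis
    using openin_subset[of "inter_topology T" X] openin_subset[of "T undefined" "topspace (inter_topology T)"]
      topspace_X openin_inter_topology[of T] openin_topspace by blast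
qed

lemma interior_operation_interior_of:
  assumes "topspace S = X" and "\<And>Y. Y \<in> R \<Longrightarrow> S interior_of Y \<in> R"
    and "\<And>Y. Y \<in> R \<Longrightarrow> f (e Y) = e (S interior_of Y)"
  shows "interior_operation alg f"
  using assms interior_of_topspace[of S] interior_of_subset[of S]
  by (auto simp: interior_operation_def interior_of_Int)

text \<open>A point of \<open>Y j\<close> has the interior of \<open>Y (Suc j)\<close> as a neighbourhood inside the union. This single
  observation gives both the induction inequality and standardness.\<close>

lemma union_of_chain_open:
  assumes "\<And>j i. Y j \<subseteq> T i interior_of (Y (Suc j))"
  shows "openin (inter_topology T) (\<Union>j. Y j)"
  unfolding openin_inter_topology
proof
  fix i
  have "\<exists>U. openin (T i) U \<and> x \<in> U \<and> U \<subseteq> (\<Union>j. Y j)" if "x \<in> (\<Union>j. Y j)" for x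
  proof -
    obtain j where "x \<in> Y j"
      using \<open>x \<in> (\<Union>j. Y j)\<close> by blast
    then have "x \<in> T i interior_of (Y (Suc j))"
      using assms by blast
    then show ?thesis
      using interior_of_subset[of "T i" "Y (Suc j)"]
      by (intro exI[of _ "T i interior_of (Y (Suc j))"]) auto
  qed
  then show "openin (T i) (\<Union>j. Y j)"
    by (subst openin_subopen) auto
qed

lemma inter_topology_open_interior:
  assumes "openin (inter_topology T) U" "U \<subseteq> Y"
  shows "U \<subseteq> T i interior_of Y"
  using assms by (simp add: interior_of_maximal openin_inter_topology)

lemma standard_alg: "standard_S4C_algebra alg"
proof
  show "x \<sqinter>\<^bsub>alg\<^esub> y \<in> carr alg" if "x \<in> carr alg" "y \<in> carr alg" for x y
    using that by auto
  show "x \<squnion>\<^bsub>alg\<^esub> y \<in> carr alg" if "x \<in> carr alg" "y \<in> carr alg" for x y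
    using that by auto
  show "compl alg x \<in> carr alg" if "x \<in> carr alg" for x
    using that by auto
  show "zero alg \<in> carr alg" "one alg \<in> carr alg"
    by auto
  have e_cong: "e Y = e Z" if "Y = Z" for Y Z
    using that by simp
  show "x \<sqinter>\<^bsub>alg\<^esub> y \<sqinter>\<^bsub>alg\<^esub> z = x \<sqinter>\<^bsub>alg\<^esub> (y \<sqinter>\<^bsub>alg\<^esub> z)"
    "x \<squnion>\<^bsub>alg\<^esub> y \<squnion>\<^bsub>alg\<^esub> z = x \<squnion>\<^bsub>alg\<^esub> (y \<squnion>\<^bsub>alg\<^esub> z)"
    "x \<sqinter>\<^bsub>alg\<^esub> (y \<squnion>\<^bsub>alg\<^esub> z) = x \<sqinter>\<^bsub>alg\<^esub> y \<squnion>\<^bsub>alg\<^esub> x \<sqinter>\<^bsub>alg\<^esub> z"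
    "x \<squnion>\<^bsub>alg\<^esub> y \<sqinter>\<^bsub>alg\<^esub> z = (x \<squnion>\<^bsub>alg\<^esub> y) \<sqinter>\<^bsub>alg\<^esub> (x \<squnion>\<^bsub>alg\<^esub> z)"
    if "x \<in> carr alg" "y \<in> carr alg" "z \<in> carr alg" for x y z
    using that by (clarsimp, (intro e_cong, blast)?)+
  show "x \<sqinter>\<^bsub>alg\<^esub> y = y \<sqinter>\<^bsub>alg\<^esub> x" "x \<squnion>\<^bsub>alg\<^esub> y = y \<squnion>\<^bsub>alg\<^esub> x"
    if "x \<in> carr alg" "y \<in> carr alg" for x y
    using that by (auto simp: Int_commute Un_commute)
  show "x \<sqinter>\<^bsub>alg\<^esub> one alg = x" "x \<squnion>\<^bsub>alg\<^esub> zero alg = x"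
    "x \<sqinter>\<^bsub>alg\<^esub> compl alg x = zero alg" "x \<squnion>\<^bsub>alg\<^esub> compl alg x = one alg"
    if "x \<in> carr alg" for x
    using that R_subset by (auto simp: Int_absorb2 Un_absorb1)
  show "interior_operation alg (box alg i)" for i
    by (rule interior_operation_interior_of[of "T i"]) (simp_all add: topspace_X)
  show "interior_operation alg (com alg)"
    by (rule interior_operation_interior_of[of "inter_topology T"]) (simp_all add: topspace_inter_topology)
  show "com alg x \<sqsubseteq>\<^bsub>alg\<^esub> everyone alg x \<sqinter>\<^bsub>alg\<^esub> everyone alg (com alg x)" if "x \<in> carr alg" for x
  proof -
    obtain Y where Y: "x = e Y" "Y \<in> R"
      using \<open>x \<in> carr alg\<close> by auto
    let ?U = "inter_topology T interior_of Y"
    have "?U \<subseteq> X"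
      using Y(2) by (simp add: R_subset)
    moreover have "?U \<subseteq> T i interior_of Y" "?U \<subseteq> T i interior_of ?U" for i
      by (simp_all add: inter_topology_open_interior interior_of_subset)
    ultimately show ?thesis
      using Y by (simp add: INT_greatest)
  qed
  show "everyone alg x \<sqinter>\<^bsub>alg\<^esub> com alg (imp alg x (everyone alg x)) \<sqsubseteq>\<^bsub>alg\<^esub> com alg x" if "x \<in> carr alg" for x
  proof -
    obtain Y where Y: "x = e Y" "Y \<in> R"
      using \<open>x \<in> carr alg\<close> by auto
    let ?E = "X \<inter> (\<Inter>i. T i interior_of Y)"
    let ?U = "inter_topology T interior_of (?E \<union> (X - Y))"
    have U: "openin (inter_topology T) ?U"
      by simp
    have UY: "Y \<inter> ?U \<subseteq> ?E"
      using interior_of_subset[of "inter_topology T" "?E \<union> (X - Y)"] by blast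
    have "Y \<inter> ?U \<subseteq> T i interior_of (Y \<inter> ?U)" for i
      using UY inter_topology_open_interior[OF U order_refl, of i] by (auto simp: interior_of_Int)
    \<comment> \<open>The set \<open>Y \<inter> ?U\<close> is open; it is treated as a constant chain.\<close>
    then have "openin (inter_topology T) (\<Union>j::nat. Y \<inter> ?U)"
      by (rule union_of_chain_open)
    then have "Y \<inter> ?U \<subseteq> inter_topology T interior_of Y"
      by (intro interior_of_maximal) auto
    moreover have "?E \<subseteq> Y"
      using interior_of_subset by fast
    ultimately have "?E \<inter> ?U \<subseteq> inter_topology T interior_of Y"
      by blast
    then show ?thesis
      using Y by simp
  qed
  show "a 0 \<sqsubseteq>\<^bsub>alg\<^esub> com alg d"
    if d: "d \<in> carr alg" and a: "\<And>j. a j \<in> carr alg"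
      and le: "\<And>j. a j \<sqsubseteq>\<^bsub>alg\<^esub> everyone alg d \<sqinter>\<^bsub>alg\<^esub> everyone alg (a (Suc j))"
    for d and a :: "nat \<Rightarrow> 'a"
  proof -
    obtain D where D: "d = e D" "D \<in> R"
      using d by auto
    have "\<exists>Y. a j = e Y \<and> Y \<in> R" for j
      using a[of j] by auto
    then obtain Y where Y: "\<And>j. a j = e (Y j)" "\<And>j. Y j \<in> R"
      by metis
    have le': "Y j \<subseteq> T i interior_of D" "Y j \<subseteq> T i interior_of (Y (Suc j))" for j i
      using le[of j] D Y by auto
    \<comment> \<open>The union is an open set that lies in \<open>D\<close> and contains \<open>Y 0\<close>.\<close>
    have "openin (inter_topology T) (\<Union>j. Y j)"
      using le'(2) by (rule union_of_chain_open)
    moreover have "(\<Union>j. Y j) \<subseteq> D"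
      using le'(1) interior_of_subset by fast
    ultimately have "Y 0 \<subseteq> inter_topology T interior_of D"
      using interior_of_maximal by blast
    then show ?thesis
      using D Y by simp
  qed
qed

end

text \<open>The values of formulas are closed under the operations of the power set algebra, because each operation is
  named by a connective, and there are only countably many of them.\<close>

lemma valuation_range_embedding:
  fixes v :: "'i::finite fm \<Rightarrow> 'x set"
  assumes model: "topological_model X T v" and inf: "infinite (UNIV :: 'a set)"
  obtains e :: "'x set \<Rightarrow> 'a" where "subset_algebra X T (range v) e"
    and "alg_valuation (subset_algebra.alg X T (range v) e) (\<lambda>p. e (v p))"
proof -
  have m: "\<And>i. topspace (T i) = X" "\<And>p. v p \<subseteq> X" "v Fls = {}"
    "\<And>p q. v (p \<^bold>\<rightarrow> q) = v q \<union> (X - v p)"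
    "\<And>i p. v (Box i p) = T i interior_of v p"
    "\<And>p. v (Com p) = inter_topology T interior_of v p"
    using model by (simp_all add: topological_model_def)
  obtain f :: "nat \<Rightarrow> 'a" where f: "inj f"
    using infinite_countable_subset[OF inf] by blast
  define e where "e = f \<circ> to_nat_on (range v)"
  have inj: "inj_on e (range v)"
    unfolding e_def by (rule comp_inj_on) (auto intro: inj_on_subset[OF f])
  have alg: "subset_algebra X T (range v) e"
  proof
    show "topspace (T i) = X" for i
      by (rule m(1))
    show "Y \<subseteq> X" if "Y \<in> range v" for Y
      using that m(2) by auto
    show "{} \<in> range v"
      using rangeI[of v Fls] by (simp only: m(3))
    show Diff: "X - Y \<in> range v" if Y: "Y \<in> range v" for Y
    proof -
      obtain p where "Y = v p"
        using Y by auto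
      then have "X - Y = v (Neg p)"
        by (simp add: m)
      then show ?thesis
        by simp
    qed
    show "Y \<union> Z \<in> range v" if YZ: "Y \<in> range v" "Z \<in> range v" for Y Z
    proof -
      obtain p q where "Y = v p" "Z = v q"
        using YZ by auto
      then have "Y \<union> Z = v (Neg p \<^bold>\<rightarrow> q)"
        using m(2)[of p] m(2)[of q] by (auto simp: m(3,4))
      then show ?thesis
        by simp
    qed
    show "T i interior_of Y \<in> range v" if "Y \<in> range v" for Y i
      using that by (auto simp flip: m(5))
    show "inter_topology T interior_of Y \<in> range v" if "Y \<in> range v" for Y
      using that by (auto simp flip: m(6))
    show "inj_on e (range v)"
      by (rule inj)
  qed
  then interpret subset_algebra X T "range v" e .
  have "alg_valuation alg (\<lambda>p. e (v p))"
    by (simp add: alg_valuation_def m(3-6))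
  with alg show thesis
    by (rule that)
qed

text \<open>The values that contain a given point \<open>x\<close> form a filter, so truth at \<open>x\<close> passes from \<open>\<Gamma>\<close> to the filter
  generated by the values of \<open>\<Gamma>\<close>.\<close>

lemma alg_local_imp_top_local:
  assumes inf: "infinite (UNIV :: 'a set)" and al: "alg_local TYPE('a) \<Gamma> p"
  shows "top_local TYPE('x) \<Gamma> p"
  unfolding top_local_def
proof (intro allI impI ballI)
  fix X :: "'x set" and T v x
  assume model: "topological_model X T v" and x: "x \<in> X" and \<Gamma>: "\<forall>q\<in>\<Gamma>. x \<in> v q"
  obtain e :: "'x set \<Rightarrow> 'a" where "subset_algebra X T (range v) e"
    and val: "alg_valuation (subset_algebra.alg X T (range v) e) (\<lambda>p. e (v p))"
    using valuation_range_embedding[OF model inf] .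
  then interpret subset_algebra X T "range v" e
    by simp
  let ?F = "e ` {Y \<in> range v. x \<in> Y}"
  have mem: "e Y \<in> ?F \<longleftrightarrow> x \<in> Y" if "Y \<in> range v" for Y
    using that e_eq_iff by auto
  have "is_filter alg ?F"
    unfolding is_filter_def
  proof (intro conjI ballI impI)
    show "?F \<subseteq> carr alg"
      by auto
    show "one alg \<in> ?F"
      using x mem by simp
    show "a \<sqinter>\<^bsub>alg\<^esub> b \<in> ?F" if ab: "a \<in> ?F" "b \<in> ?F" for a b
    proof -
      obtain Y Z where "a = e Y" "Y \<in> range v" "x \<in> Y" "b = e Z" "Z \<in> range v" "x \<in> Z"
        using ab by auto
      then show ?thesis
        using mem[of "Y \<inter> Z"] by simp
    qed
    show "b \<in> ?F" if ab: "a \<in> ?F" "b \<in> carr alg" "a \<sqsubseteq>\<^bsub>alg\<^esub> b" for a b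
    proof -
      obtain Y Z where "a = e Y" "Y \<in> range v" "x \<in> Y" "b = e Z" "Z \<in> range v"
        using ab(1,2) by auto
      then show ?thesis
        using ab(3) mem[of Z] by auto
    qed
  qed
  moreover have "(\<lambda>p. e (v p)) ` \<Gamma> \<subseteq> ?F"
    using \<Gamma> by auto
  moreover have "e (v p) \<in> generated_filter alg ((\<lambda>p. e (v p)) ` \<Gamma>)"
    using al[unfolded alg_local_def, rule_format, OF standard_alg val] .
  ultimately have "e (v p) \<in> ?F"
    by (simp add: generated_filter_def)
  then show "x \<in> v p"
    using mem by simp
qed

lemma alg_global_imp_top_global:
  assumes inf: "infinite (UNIV :: 'a set)" and ag: "alg_global TYPE('a) \<Sigma> p"
  shows "top_global TYPE('x) \<Sigma> p"
  unfolding top_global_def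
proof (intro allI impI)
  fix X :: "'x set" and T v
  assume model: "topological_model X T v" and \<Sigma>: "\<forall>s\<in>\<Sigma>. v s = X"
  obtain e :: "'x set \<Rightarrow> 'a" where "subset_algebra X T (range v) e"
    and val: "alg_valuation (subset_algebra.alg X T (range v) e) (\<lambda>p. e (v p))"
    using valuation_range_embedding[OF model inf] .
  then interpret subset_algebra X T "range v" e
    by simp
  have "e (v p) = e X"
    using ag[unfolded alg_global_def, rule_format, OF standard_alg val] \<Sigma> by simp
  then show "v p = X"
    using e_eq_iff[of "v p" X] by simp
qed

lemma derivable_local_imp_alg_local: "\<Gamma> \<turnstile>\<^sub>l p \<Longrightarrow> alg_local t \<Gamma> p"
  by (auto simp: alg_local_def standard_S4C_algebra_def intro: S4C_algebra.derivable_local_sound)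

lemma derivable_global_imp_alg_global: "\<Sigma> \<turnstile>\<^sub>g p \<Longrightarrow> alg_global t \<Sigma> p"
  unfolding alg_global_def using standard_S4C_algebra.derivable_global_sound by blast

section \<open>Maximal consistent sets\<close>

text \<open>A logic is any set of formulas that contains the axioms and is closed under the finitary rules. The two
  instances of interest are the theorems of the calculus and the formulas globally derivable from a fixed set.\<close>

locale s4c_logic =
  fixes L :: "'i::finite fm \<Rightarrow> bool"
  assumes L_axiom: "S4C_axiom p \<Longrightarrow> L p"
    and L_mp: "L p \<Longrightarrow> L (p \<^bold>\<rightarrow> q) \<Longrightarrow> L q"
    and L_nec: "L p \<Longrightarrow> L (Com p)"
begin

definition entails :: "'i fm set \<Rightarrow> 'i fm \<Rightarrow> bool" where
  "entails \<Gamma> p \<longleftrightarrow> (\<exists>ps. set ps \<subseteq> \<Gamma> \<and> L (big_conj ps \<^bold>\<rightarrow> p))"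

text \<open>The last two clauses say that membership is a two-valued propositional valuation, which is equivalent to
  maximality among the consistent sets that contain \<open>L\<close>.\<close>

definition maximal_consistent :: "'i fm set \<Rightarrow> bool" where
  "maximal_consistent x \<longleftrightarrow>
     (\<forall>p. L p \<longrightarrow> p \<in> x) \<and> Fls \<notin> x \<and> (\<forall>p q. (p \<^bold>\<rightarrow> q) \<in> x \<longleftrightarrow> (p \<in> x \<longrightarrow> q \<in> x))"

lemma L_taut: "(\<And>h. prop_eval h p) \<Longrightarrow> L p"
  by (simp add: L_axiom taut tautology_def)

lemma entails_assumption: "p \<in> \<Gamma> \<Longrightarrow> entails \<Gamma> p"
  unfolding entails_def by (intro exI[of _ "[p]"]) (simp add: L_taut)

lemma entails_theorem: "L p \<Longrightarrow> entails \<Gamma> p"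
  using L_mp[of p "Tru \<^bold>\<rightarrow> p"] L_taut[of "p \<^bold>\<rightarrow> Tru \<^bold>\<rightarrow> p"] unfolding entails_def
  by (intro exI[of _ "[]"]) simp

lemma entails_taut:
  assumes "entails \<Gamma> p" "entails \<Gamma> q" and taut: "\<And>h. prop_eval h p \<Longrightarrow> prop_eval h q \<Longrightarrow> prop_eval h r"
  shows "entails \<Gamma> r"
proof -
  obtain ps qs where ps: "set ps \<subseteq> \<Gamma>" "L (big_conj ps \<^bold>\<rightarrow> p)" and qs: "set qs \<subseteq> \<Gamma>" "L (big_conj qs \<^bold>\<rightarrow> q)"
    using assms(1,2) by (auto simp: entails_def)
  have "L ((big_conj ps \<^bold>\<rightarrow> p) \<^bold>\<rightarrow> (big_conj qs \<^bold>\<rightarrow> q) \<^bold>\<rightarrow> big_conj (ps @ qs) \<^bold>\<rightarrow> r)"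
    using taut by (intro L_taut) (auto simp: prop_eval_big_conj)
  then have "L (big_conj (ps @ qs) \<^bold>\<rightarrow> r)"
    using ps(2) qs(2) L_mp by blast
  then show ?thesis
    using ps(1) qs(1) unfolding entails_def by (intro exI[of _ "ps @ qs"]) simp
qed

lemma entails_deduction:
  assumes "entails (insert p \<Gamma>) q"
  shows "entails \<Gamma> (p \<^bold>\<rightarrow> q)"
proof -
  obtain ps where ps: "set ps \<subseteq> insert p \<Gamma>" "L (big_conj ps \<^bold>\<rightarrow> q)"
    using assms by (auto simp: entails_def)
  have "L ((big_conj ps \<^bold>\<rightarrow> q) \<^bold>\<rightarrow> big_conj (removeAll p ps) \<^bold>\<rightarrow> p \<^bold>\<rightarrow> q)"
    by (intro L_taut) (auto simp: prop_eval_big_conj)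
  then have "L (big_conj (removeAll p ps) \<^bold>\<rightarrow> p \<^bold>\<rightarrow> q)"
    using ps(2) L_mp by blast
  then show ?thesis
    using ps(1) unfolding entails_def by (intro exI[of _ "removeAll p ps"]) auto
qed

lemma entails_chain:
  assumes "entails (\<Union>\<C>) p" "\<C> \<noteq> {}" and tot: "\<And>F G. F \<in> \<C> \<Longrightarrow> G \<in> \<C> \<Longrightarrow> F \<subseteq> G \<or> G \<subseteq> F"
  shows "\<exists>F\<in>\<C>. entails F p"
proof -
  obtain ps where ps: "set ps \<subseteq> \<Union>\<C>" "L (big_conj ps \<^bold>\<rightarrow> p)"
    using assms(1) by (auto simp: entails_def)
  have "\<exists>F\<in>\<C>. set ps \<subseteq> F"
    using ps(1)
  proof (induction ps)
    case Nil
    then show ?case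
      using assms(2) by auto
  next
    case (Cons q ps)
    then obtain F G where "F \<in> \<C>" "set ps \<subseteq> F" "G \<in> \<C>" "q \<in> G"
      by auto
    then show ?case
      using tot[of F G] by (metis insert_subset list.simps(15) subset_trans subsetD)
  qed
  then show ?thesis
    using ps(2) by (auto simp: entails_def)
qed

text \<open>The lemma of Lindenbaum: a set that is maximal among the supersets of \<open>\<Gamma>\<close> not entailing \<open>p\<close> is closed under
  entailment, and an implication is missing from it only if its premise is present and its conclusion missing.\<close>

lemma maximal_consistent_extension:
  assumes "\<not> entails \<Gamma> p"
  shows "\<exists>x. maximal_consistent x \<and> \<Gamma> \<subseteq> x \<and> p \<notin> x"
proof -
  let ?S = "{\<Delta>. \<Gamma> \<subseteq> \<Delta> \<and> \<not> entails \<Delta> p}"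
  have "\<Gamma> \<in> ?S"
    using assms by blast
  moreover have "\<Union>\<C> \<in> ?S" if "\<C> \<noteq> {}" "subset.chain ?S \<C>" for \<C>
  proof -
    have S: "\<And>F. F \<in> \<C> \<Longrightarrow> \<Gamma> \<subseteq> F \<and> \<not> entails F p"
      and tot: "\<And>F G. F \<in> \<C> \<Longrightarrow> G \<in> \<C> \<Longrightarrow> F \<subseteq> G \<or> G \<subseteq> F"
      using that(2) by (auto simp: subset_chain_def)
    have "\<not> entails (\<Union>\<C>) p"
      using entails_chain[OF _ that(1) tot] S by blast
    moreover have "\<Gamma> \<subseteq> \<Union>\<C>"
      using S that(1) by blast
    ultimately show ?thesis
      by blast
  qed
  ultimately obtain x where x: "\<Gamma> \<subseteq> x" "\<not> entails x p"
    and max: "\<And>\<Delta>. \<Delta> \<in> ?S \<Longrightarrow> x \<subseteq> \<Delta> \<Longrightarrow> \<Delta> = x"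
    using subset_Zorn_nonempty[of ?S] by auto
  have entails_insert: "entails (insert q x) p" if "q \<notin> x" for q
    using max[of "insert q x"] x(1) that by blast
  have mem: "q \<in> x \<longleftrightarrow> entails x q" for q
  proof
    show "q \<in> x" if "entails x q"
    proof (rule ccontr)
      assume "q \<notin> x"
      then have "entails x (q \<^bold>\<rightarrow> p)"
        using entails_insert entails_deduction by blast
      then have "entails x p"
        using that by (rule entails_taut) simp
      then show False
        using x(2) by blast
    qed
  qed (rule entails_assumption)
  have "maximal_consistent x"
    unfolding maximal_consistent_def
  proof (intro conjI allI impI)
    show "q \<in> x" if "L q" for q
      using that mem entails_theorem by blast
    show "Fls \<notin> x"
      using x(2) mem entails_taut[of x Fls Fls p] by auto
    show "(q \<^bold>\<rightarrow> r) \<in> x \<longleftrightarrow> (q \<in> x \<longrightarrow> r \<in> x)" for q r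
    proof
      show "q \<in> x \<longrightarrow> r \<in> x" if "(q \<^bold>\<rightarrow> r) \<in> x"
        using that mem entails_taut[of x "q \<^bold>\<rightarrow> r" q r] by auto
      show "(q \<^bold>\<rightarrow> r) \<in> x" if "q \<in> x \<longrightarrow> r \<in> x"
      proof (cases "q \<in> x")
        case True
        then show ?thesis
          using that mem entails_taut[of x r r "q \<^bold>\<rightarrow> r"] by auto
      next
        case False
        show ?thesis
        proof (rule ccontr)
          assume "(q \<^bold>\<rightarrow> r) \<notin> x"
          then have "entails x (q \<^bold>\<rightarrow> p)" "entails x ((q \<^bold>\<rightarrow> r) \<^bold>\<rightarrow> p)"
            using False entails_insert entails_deduction by blast+
          \<comment> \<open>One of \<open>q\<close> and \<open>q \<^bold>\<rightarrow> r\<close> always holds, and both imply \<open>p\<close>.\<close>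
          then have "entails x p"
            by (rule entails_taut) auto
          then show False
            using x(2) by blast
        qed
      qed
    qed
  qed
  moreover have "p \<notin> x"
    using mem x(2) by blast
  ultimately show ?thesis
    using x(1) by blast
qed

lemma L_iff_maximal_consistent: "L p \<longleftrightarrow> (\<forall>x. maximal_consistent x \<longrightarrow> p \<in> x)"
proof
  show "\<forall>x. maximal_consistent x \<longrightarrow> p \<in> x" if "L p"
    using that by (simp add: maximal_consistent_def)
  show "L p" if all: "\<forall>x. maximal_consistent x \<longrightarrow> p \<in> x"
  proof -
    have "entails {} p"
      using maximal_consistent_extension all by blast
    then show ?thesis
      using L_mp[of Tru p] L_taut[of Tru] by (simp add: entails_def)
  qed
qed

end

section \<open>Sets of worlds defined by formulas\<close>

text \<open>The points are elements of an arbitrary type, labelled with maximal consistent sets by \<open>th\<close>. In this way the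
  model can be built over any type that is large enough to hold all the maximal consistent sets.\<close>

locale canonical_worlds = s4c_logic L for L :: "'i::finite fm \<Rightarrow> bool" +
  fixes W :: "'w set" and th :: "'w \<Rightarrow> 'i fm set"
  assumes worlds: "th ` W = Collect maximal_consistent"
begin

definition hat :: "'i fm \<Rightarrow> 'w set" where
  "hat p = {w \<in> W. p \<in> th w}"

lemma maximal_consistent_th: "w \<in> W \<Longrightarrow> maximal_consistent (th w)"
  using worlds by blast

lemma L_iff_hat: "L p \<longleftrightarrow> hat p = W"
proof -
  have "L p \<longleftrightarrow> (\<forall>x\<in>th ` W. p \<in> x)"
    by (simp add: L_iff_maximal_consistent worlds)
  then show ?thesis
    by (auto simp: hat_def)
qed

lemma hat_subset: "hat p \<subseteq> W"
  by (auto simp: hat_def)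

lemma hat_Fls: "hat Fls = {}"
  using maximal_consistent_th by (auto simp: hat_def maximal_consistent_def)

lemma hat_Imp: "hat (p \<^bold>\<rightarrow> q) = hat q \<union> (W - hat p)"
  using maximal_consistent_th by (auto simp: hat_def maximal_consistent_def)

lemma hat_Conj: "hat (p \<^bold>\<and> q) = hat p \<inter> hat q"
  using hat_subset by (auto simp: hat_Imp hat_Fls)

lemma prop_eval_hat: "w \<in> W \<Longrightarrow> prop_eval (\<lambda>q. w \<in> hat q) p \<longleftrightarrow> w \<in> hat p"
  by (induction p) (auto simp: hat_Fls hat_Imp)

lemma hat_Everyone: "hat (Everyone p) = W \<inter> (\<Inter>i. hat (Box i p))"
  using prop_eval_hat[of _ "Everyone p"] hat_subset by (auto simp: prop_eval_Everyone)

text \<open>From here on, reasoning inside the logic is set-theoretic reasoning about the sets \<open>hat p\<close>.\<close>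

lemma L_Imp_iff: "L (p \<^bold>\<rightarrow> q) \<longleftrightarrow> hat p \<subseteq> hat q"
  using hat_subset by (auto simp: L_iff_hat hat_Imp)

lemma hat_com_unfold: "hat (Com p) \<subseteq> hat (Everyone p)" "hat (Com p) \<subseteq> hat (Everyone (Com p))"
  using L_axiom[OF com_unfold[of p]] by (simp_all add: L_Imp_iff hat_Conj)

lemma hat_Box_T: "hat (Box i p) \<subseteq> hat p"
  using L_axiom[OF box_T[of i p]] by (simp add: L_Imp_iff)

lemma hat_Box_4: "hat (Box i p) \<subseteq> hat (Box i (Box i p))"
  using L_axiom[OF box_4[of i p]] by (simp add: L_Imp_iff)

lemma hat_Com_Box: "hat (Com p) \<subseteq> hat (Box i p)" "hat (Com p) \<subseteq> hat (Box i (Com p))"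
  using hat_com_unfold[of p] by (auto simp: hat_Everyone)

lemma L_nec_Box: "L p \<Longrightarrow> L (Box i p)"
  using L_nec[of p] hat_Com_Box(1)[of p i] hat_subset[of "Box i p"] by (simp add: L_iff_hat)

lemma hat_Box_mono:
  assumes "hat p \<subseteq> hat q"
  shows "hat (Box i p) \<subseteq> hat (Box i q)"
proof -
  have "L (Box i (p \<^bold>\<rightarrow> q))"
    using assms by (intro L_nec_Box) (simp add: L_Imp_iff)
  then have "L (Box i p \<^bold>\<rightarrow> Box i q)"
    using L_axiom[OF box_K] L_mp by blast
  then show ?thesis
    by (simp add: L_Imp_iff)
qed

lemma hat_Everyone_mono: "hat p \<subseteq> hat q \<Longrightarrow> hat (Everyone p) \<subseteq> hat (Everyone q)"
  using hat_Box_mono[of p q] by (auto simp: hat_Everyone)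

lemma hat_Com_mono:
  assumes "hat p \<subseteq> hat q"
  shows "hat (Com p) \<subseteq> hat (Com q)"
proof -
  have "L (Com (p \<^bold>\<rightarrow> q))"
    using assms by (intro L_nec) (simp add: L_Imp_iff)
  then have "L (Com p \<^bold>\<rightarrow> Com q)"
    using L_axiom[OF com_K] L_mp by blast
  then show ?thesis
    by (simp add: L_Imp_iff)
qed

lemma hat_Box_Int: "hat (Box i p) \<inter> hat (Box i q) \<subseteq> hat (Box i (p \<^bold>\<and> q))"
proof -
  have "hat (Box i p) \<subseteq> hat (Box i (q \<^bold>\<rightarrow> p \<^bold>\<and> q))"
    using hat_subset by (intro hat_Box_mono) (auto simp: hat_Imp hat_Fls)
  moreover have "hat (Box i (q \<^bold>\<rightarrow> p \<^bold>\<and> q)) \<subseteq> hat (Box i q \<^bold>\<rightarrow> Box i (p \<^bold>\<and> q))"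
    using L_axiom[OF box_K] by (simp only: L_Imp_iff)
  ultimately show ?thesis
    by (auto simp: hat_Imp)
qed

text \<open>Compactness holds because entailment is finitary: the cover makes \<open>a\<close> together with the negations of the
  members of \<open>D\<close> inconsistent, and the finitely many formulas used in a proof of this give the subcover.\<close>

lemma compact_hat:
  assumes cover: "hat a \<subseteq> (\<Union>c\<in>D. hat c)"
  shows "\<exists>D0. finite D0 \<and> D0 \<subseteq> D \<and> hat a \<subseteq> (\<Union>c\<in>D0. hat c)"
proof -
  have "entails (insert a (Neg ` D)) Fls"
  proof (rule ccontr)
    assume "\<not> entails (insert a (Neg ` D)) Fls"
    from maximal_consistent_extension[OF this]
    obtain x where x: "maximal_consistent x" "a \<in> x" "\<And>c. c \<in> D \<Longrightarrow> Neg c \<in> x"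
      by auto
    then have "x \<in> th ` W"
      using worlds by simp
    then obtain w where w: "w \<in> W" "th w = x"
      by auto
    then have "w \<in> hat a"
      using x(2) by (simp add: hat_def)
    then obtain c where "c \<in> D" "c \<in> x"
      using cover w by (auto simp: hat_def)
    then show False
      using x(1) x(3)[of c] by (simp add: maximal_consistent_def)
  qed
  then obtain ps where ps: "set ps \<subseteq> insert a (Neg ` D)" "L (big_conj ps \<^bold>\<rightarrow> Fls)"
    by (auto simp: entails_def)
  let ?D0 = "{c \<in> D. Neg c \<in> set ps}"
  have "finite (Neg -` set ps)"
    by (rule finite_vimageI) (auto simp: inj_def)
  then have "finite ?D0"
    by (rule rev_finite_subset) auto
  moreover have "hat a \<subseteq> (\<Union>c\<in>?D0. hat c)"
  proof
    fix w
    assume w: "w \<in> hat a"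
    then have wW: "w \<in> W"
      by (simp add: hat_def)
    have "w \<in> hat (big_conj qs) \<longleftrightarrow> (\<forall>q\<in>set qs. w \<in> hat q)" for qs
      using wW by (induction qs rule: big_conj.induct) (auto simp: hat_Imp hat_Fls)
    moreover have "w \<notin> hat (big_conj ps)"
      using ps(2) by (auto simp: L_Imp_iff hat_Fls)
    ultimately obtain q where q: "q \<in> set ps" "w \<notin> hat q"
      by blast
    then obtain c where "q = Neg c" "c \<in> D"
      using ps(1) w by blast
    then show "w \<in> (\<Union>c\<in>?D0. hat c)"
      using q wW by (auto simp: hat_Imp hat_Fls)
  qed
  ultimately show ?thesis
    by blast
qed

text \<open>The union is defined by the disjunction of \<open>D\<close>. The set \<open>B\<close> records that the disjunction stays within the
  fragment from which the members of \<open>D\<close> are taken.\<close>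

lemma finite_union_hat:
  assumes "finite D" "D \<subseteq> B" and "Fls \<in> B" and B_Imp: "\<And>p q. p \<in> B \<Longrightarrow> q \<in> B \<Longrightarrow> (p \<^bold>\<rightarrow> q) \<in> B"
  shows "\<exists>u\<in>B. hat u = (\<Union>c\<in>D. hat c)"
  using assms(1,2)
proof (induction D)
  case empty
  then show ?case
    using hat_Fls \<open>Fls \<in> B\<close> by auto
next
  case (insert c D)
  then obtain u where "u \<in> B" "hat u = (\<Union>c\<in>D. hat c)"
    by auto
  then show ?case
    using insert.prems hat_subset \<open>Fls \<in> B\<close>
    by (intro bexI[of _ "Neg c \<^bold>\<rightarrow> u"]) (auto simp: hat_Imp hat_Fls B_Imp)
qed

text \<open>If the \<open>f j\<close> are finitely many up to equivalence, they have a disjunction \<open>u\<close>. The premises of the rule \<open>\<omega>\<close>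
  say that \<open>u\<close> implies \<open>Everyone u\<close> and \<open>Everyone q\<close>, and the induction axiom yields that \<open>u\<close> implies \<open>Com u\<close>.\<close>

lemma omega_rule_finite:
  assumes fin: "finite (range (\<lambda>j::nat. hat (f j)))"
    and prem: "\<And>j. L (f j \<^bold>\<rightarrow> Everyone q \<^bold>\<and> Everyone (f (Suc j)))"
  shows "L (f 0 \<^bold>\<rightarrow> Com q)"
proof -
  have f: "hat (f j) \<subseteq> hat (Everyone q)" "hat (f j) \<subseteq> hat (Everyone (f (Suc j)))" for j
    using prem[of j] by (simp_all add: L_Imp_iff hat_Conj)
  have "finite (hat ` range f)"
    using fin by (simp add: image_image)
  then obtain D where D: "D \<subseteq> range f" "finite D" "hat ` range f = hat ` D"
    using finite_subset_image[of "hat ` range f" hat "range f"] by auto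
  then obtain u where "hat u = (\<Union>c\<in>D. hat c)"
    using finite_union_hat[of D UNIV] by auto
  then have u: "hat u = (\<Union>j. hat (f j))"
    using D(3) by (metis image_image)
  have "hat (f j) \<subseteq> hat (Everyone u)" for j
    using f(2)[of j] hat_Everyone_mono[of "f (Suc j)" u] u by blast
  then have uE: "hat u \<subseteq> hat (Everyone u)"
    unfolding u by (rule UN_least)
  then have "L (Com (u \<^bold>\<rightarrow> Everyone u))"
    by (intro L_nec) (simp add: L_Imp_iff)
  moreover have "hat (Everyone u) \<inter> hat (Com (u \<^bold>\<rightarrow> Everyone u)) \<subseteq> hat (Com u)"
    using L_axiom[OF com_induct[of u]] unfolding L_Imp_iff hat_Conj .
  ultimately have uC: "hat u \<subseteq> hat (Com u)"
    using uE hat_subset[of u] unfolding L_iff_hat by blast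
  have "hat (Everyone q) \<subseteq> hat q"
    using hat_Box_T[of undefined q] by (auto simp: hat_Everyone)
  then have "hat u \<subseteq> hat q"
    using f(1) u by blast
  then have "hat (Com u) \<subseteq> hat (Com q)"
    by (rule hat_Com_mono)
  then show ?thesis
    using uC u unfolding L_Imp_iff by blast
qed

end

section \<open>The canonical topological model\<close>

text \<open>The set \<open>B\<close> is a fragment of the language, closed under subformulas and Boolean combinations, from which
  the basic open sets are taken. With all formulas as \<open>B\<close> one obtains the canonical model proper; with the
  Boolean combinations of finitely many formulas, a filtration of it. Closure under the rule \<open>\<omega>\<close> is
  demanded for sequences in \<open>B\<close>, which is the form in which a filtration can supply it.\<close>

locale canonical_model = canonical_worlds L W th
  for L :: "'i::finite fm \<Rightarrow> bool" and W :: "'w set" and th :: "'w \<Rightarrow> 'i fm set" +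
  fixes B :: "'i fm set"
  assumes B_Fls: "Fls \<in> B"
    and B_Imp: "(p \<^bold>\<rightarrow> q) \<in> B \<longleftrightarrow> p \<in> B \<and> q \<in> B"
    and B_Box: "Box i p \<in> B \<Longrightarrow> p \<in> B"
    and B_Com: "Com p \<in> B \<Longrightarrow> p \<in> B"
    and B_omega: "(\<And>j. f j \<in> B) \<Longrightarrow> (\<And>j. L (f j \<^bold>\<rightarrow> Everyone q \<^bold>\<and> Everyone (f (Suc j)))) \<Longrightarrow>
      L (f (0::nat) \<^bold>\<rightarrow> Com q)"
begin

definition persistent :: "'i \<Rightarrow> 'i fm set" where
  "persistent i = {c \<in> B. hat c \<subseteq> hat (Box i c)}"

definition T :: "'i \<Rightarrow> 'w topology" where
  "T i = topology (\<lambda>U. \<forall>w\<in>U. \<exists>c\<in>persistent i. w \<in> hat c \<and> hat c \<subseteq> U)"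

lemma persistent_Conj: "c \<in> persistent i \<Longrightarrow> d \<in> persistent i \<Longrightarrow> (c \<^bold>\<and> d) \<in> persistent i"
  using hat_Box_Int[of i c d] unfolding persistent_def hat_Conj mem_Collect_eq B_Imp
  by (simp add: B_Fls) blast

lemma openin_T: "openin (T i) U \<longleftrightarrow> (\<forall>w\<in>U. \<exists>c\<in>persistent i. w \<in> hat c \<and> hat c \<subseteq> U)"
proof -
  have "istopology (\<lambda>U. \<forall>w\<in>U. \<exists>c\<in>persistent i. w \<in> hat c \<and> hat c \<subseteq> U)"
    unfolding istopology_def
  proof (intro conjI allI impI ballI)
    show "\<exists>c\<in>persistent i. w \<in> hat c \<and> hat c \<subseteq> U \<inter> V"
      if U: "\<forall>w\<in>U. \<exists>c\<in>persistent i. w \<in> hat c \<and> hat c \<subseteq> U"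
        and V: "\<forall>w\<in>V. \<exists>c\<in>persistent i. w \<in> hat c \<and> hat c \<subseteq> V"
        and w: "w \<in> U \<inter> V" for U V w
    proof -
      obtain c where c: "c \<in> persistent i" "w \<in> hat c" "hat c \<subseteq> U"
        using bspec[OF U, of w] w by auto
      obtain d where d: "d \<in> persistent i" "w \<in> hat d" "hat d \<subseteq> V"
        using bspec[OF V, of w] w by auto
      have "w \<in> hat (c \<^bold>\<and> d)" "hat (c \<^bold>\<and> d) \<subseteq> U \<inter> V"
        using c d unfolding hat_Conj by auto
      then show ?thesis
        using persistent_Conj[OF c(1) d(1)] by blast
    qed
    show "\<exists>c\<in>persistent i. w \<in> hat c \<and> hat c \<subseteq> \<Union>\<K>"
      if \<K>: "\<forall>K\<in>\<K>. \<forall>w\<in>K. \<exists>c\<in>persistent i. w \<in> hat c \<and> hat c \<subseteq> K"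
        and w: "w \<in> \<Union>\<K>" for \<K> w
    proof -
      obtain K where K: "K \<in> \<K>" "w \<in> K"
        using w by blast
      then obtain c where "c \<in> persistent i" "w \<in> hat c" "hat c \<subseteq> K"
        using bspec[OF bspec[OF \<K> K(1)] K(2)] by blast
      then show ?thesis
        using K(1) by blast
    qed
  qed
  then show ?thesis
    unfolding T_def by (simp only: topology_inverse')
qed

lemma topspace_T: "topspace (T i) = W"
proof
  have "L Tru"
    by (rule L_taut) simp
  then have Tru: "Tru \<in> persistent i" "hat Tru = W"
    using L_nec_Box[of Tru i] by (simp_all add: persistent_def B_Imp B_Fls L_iff_hat)
  have "openin (T i) W"
    unfolding openin_T by (intro ballI bexI[of _ Tru] conjI) (simp_all add: Tru)
  then show "W \<subseteq> topspace (T i)"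
    by (rule openin_subset)
  show "topspace (T i) \<subseteq> W"
  proof
    fix w
    assume "w \<in> topspace (T i)"
    then obtain c where "w \<in> hat c"
      using openin_topspace[of "T i"] unfolding openin_T by blast
    then show "w \<in> W"
      by (simp add: hat_def)
  qed
qed

lemma openin_hat:
  assumes "c \<in> persistent i"
  shows "openin (T i) (hat c)"
proof -
  have "\<exists>d\<in>persistent i. w \<in> hat d \<and> hat d \<subseteq> hat c" if w: "w \<in> hat c" for w
  proof (rule bexI[of _ c])
    show "w \<in> hat c \<and> hat c \<subseteq> hat c"
      by (rule conjI[OF w subset_refl])
    show "c \<in> persistent i"
      by (rule assms)
  qed
  then show ?thesis
    unfolding openin_T by (rule ballI)
qed

lemma finite_union_in_B: "finite D \<Longrightarrow> D \<subseteq> B \<Longrightarrow> \<exists>u\<in>B. hat u = (\<Union>c\<in>D. hat c)"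
  by (rule finite_union_hat) (simp_all add: B_Fls B_Imp)

text \<open>Cover \<open>hat a\<close> by basic open subsets of \<open>U\<close>, take a finite subcover, and let \<open>u\<close> be the disjunction of its
  members \<open>c\<close>. Each \<open>c\<close> implies \<open>Box i c\<close>, hence \<open>Box i u\<close>.\<close>

lemma open_interpolant:
  assumes U: "openin (T i) U" and a: "hat a \<subseteq> U"
  shows "\<exists>u\<in>B. hat a \<subseteq> hat (Box i u) \<and> hat u \<subseteq> U"
proof -
  let ?D = "{c \<in> persistent i. hat c \<subseteq> U}"
  have "hat a \<subseteq> (\<Union>c\<in>?D. hat c)"
  proof
    fix w
    assume "w \<in> hat a"
    then obtain c where "c \<in> persistent i" "w \<in> hat c" "hat c \<subseteq> U"
      using bspec[OF U[unfolded openin_T], of w] a by auto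
    then show "w \<in> (\<Union>c\<in>?D. hat c)"
      by simp (rule exI[of _ c], simp)
  qed
  from compact_hat[OF this]
  obtain D0 where D0: "finite D0" "D0 \<subseteq> ?D" "hat a \<subseteq> (\<Union>c\<in>D0. hat c)"
    by auto
  then have "D0 \<subseteq> B"
    by (auto simp: persistent_def)
  with \<open>finite D0\<close> obtain u where u: "u \<in> B" "hat u = (\<Union>c\<in>D0. hat c)"
    using finite_union_in_B by blast
  have "hat c \<subseteq> hat (Box i u)" if c: "c \<in> D0" for c
  proof -
    have "hat c \<subseteq> hat (Box i c)"
      using c D0(2) by (auto simp: persistent_def)
    also have "\<dots> \<subseteq> hat (Box i u)"
      using c u(2) by (intro hat_Box_mono) auto
    finally show ?thesis .
  qed
  then have "hat a \<subseteq> hat (Box i u)"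
    using D0(3) by (meson UN_least subset_trans)
  moreover have "hat u \<subseteq> U"
    using u(2) D0(2) by auto
  ultimately show ?thesis
    using u(1) by auto
qed

text \<open>The interpolants for the single indices are combined into their disjunction. The index type is finite, so this is
  a formula.\<close>

lemma open_interpolant_Everyone:
  assumes U: "openin (inter_topology T) U" and a: "hat a \<subseteq> U"
  shows "\<exists>u\<in>B. hat a \<subseteq> hat (Everyone u) \<and> hat u \<subseteq> U"
proof -
  have "\<exists>u\<in>B. hat a \<subseteq> hat (Box i u) \<and> hat u \<subseteq> U" for i
    using open_interpolant[of i U a] U a by (simp add: openin_inter_topology)
  then obtain g where g: "\<And>i. g i \<in> B" "\<And>i. hat a \<subseteq> hat (Box i (g i))" "\<And>i. hat (g i) \<subseteq> U"
    by metis
  from g(1) have "range g \<subseteq> B"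
    by auto
  then obtain u where u: "u \<in> B" "hat u = (\<Union>c\<in>range g. hat c)"
    using finite_union_in_B[of "range g"] by auto
  have "hat a \<subseteq> hat (Box i u)" for i
    using g(2)[of i] hat_Box_mono[of "g i" u i] u(2) by blast
  then have "hat a \<subseteq> hat (Everyone u)"
    using hat_subset[of a] by (simp add: hat_Everyone INT_greatest)
  moreover have "hat u \<subseteq> U"
    using u(2) g(3) by (simp add: UN_least)
  ultimately show ?thesis
    using u(1) by blast
qed

lemma interior_of_Box:
  assumes "Box i p \<in> B"
  shows "T i interior_of hat p = hat (Box i p)"
proof
  have "Box i p \<in> persistent i"
    using assms hat_Box_4 by (simp add: persistent_def)
  then show "hat (Box i p) \<subseteq> T i interior_of hat p"
    using hat_Box_T by (intro interior_of_maximal openin_hat)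
  show "T i interior_of hat p \<subseteq> hat (Box i p)"
  proof
    fix w
    assume "w \<in> T i interior_of hat p"
    moreover have "openin (T i) (T i interior_of hat p)"
      by simp
    ultimately obtain c where "c \<in> persistent i" "w \<in> hat c" "hat c \<subseteq> T i interior_of hat p"
      unfolding openin_T by blast
    then have "c \<in> persistent i" "w \<in> hat c" "hat c \<subseteq> hat p"
      using interior_of_subset[of "T i" "hat p"] by auto
    then show "w \<in> hat (Box i p)"
      using hat_Box_mono[of c p i] by (auto simp: persistent_def)
  qed
qed

text \<open>For the inclusion from left to right, start with a formula \<open>c\<close> whose set lies in the interior \<open>U\<close>, and apply
  \<open>open_interpolant_Everyone\<close> again and again. All the sets obtained lie in \<open>U\<close>, hence in \<open>hat p\<close>, so the
  sequence satisfies the premises of the rule \<open>\<omega>\<close> and \<open>c\<close> implies \<open>Com p\<close>.\<close>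

lemma interior_of_Com:
  assumes "Com p \<in> B"
  shows "inter_topology T interior_of hat p = hat (Com p)"
proof
  have "Com p \<in> persistent i" for i
    using assms hat_Com_Box by (simp add: persistent_def)
  then have "openin (inter_topology T) (hat (Com p))"
    by (simp add: openin_inter_topology openin_hat)
  then show "hat (Com p) \<subseteq> inter_topology T interior_of hat p"
    using hat_Com_Box(1) hat_Box_T by (intro interior_of_maximal) blast+
  show "inter_topology T interior_of hat p \<subseteq> hat (Com p)"
  proof
    fix w
    let ?U = "inter_topology T interior_of hat p"
    assume "w \<in> ?U"
    have U: "openin (inter_topology T) ?U" "?U \<subseteq> hat p"
      by (simp_all add: interior_of_subset)
    \<comment> \<open>Any index will do to find a basic open set around \<open>w\<close>.\<close>
    from U(1) have "openin (T undefined) ?U"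
      unfolding openin_inter_topology by (rule spec)
    with \<open>w \<in> ?U\<close> obtain c where "c \<in> persistent undefined" "w \<in> hat c" "hat c \<subseteq> ?U"
      unfolding openin_T by blast
    then have c: "c \<in> B" "w \<in> hat c" "hat c \<subseteq> ?U"
      by (simp_all add: persistent_def)
    have "\<exists>f. \<forall>n. (f n \<in> B \<and> hat (f n) \<subseteq> ?U \<and> (n = 0 \<longrightarrow> f n = c)) \<and>
        hat (f n) \<subseteq> hat (Everyone (f (Suc n)))"
    proof (rule dependent_nat_choice)
      show "\<exists>u. (u \<in> B \<and> hat u \<subseteq> ?U \<and> (Suc n = 0 \<longrightarrow> u = c)) \<and> hat a \<subseteq> hat (Everyone u)"
        if "a \<in> B \<and> hat a \<subseteq> ?U \<and> (n = 0 \<longrightarrow> a = c)" for a and n :: nat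
        using open_interpolant_Everyone[OF U(1), of a] that by auto
    qed (use c in auto)
    then obtain f where f: "\<And>j. f j \<in> B" "\<And>j. hat (f j) \<subseteq> ?U" "\<And>j. hat (f j) \<subseteq> hat (Everyone (f (Suc j)))"
      and f0: "f (0::nat) = c"
      by metis
    have "hat (f j) \<subseteq> hat (Everyone p)" for j
    proof -
      have "hat (f (Suc j)) \<subseteq> hat p"
        using f(2)[of "Suc j"] U(2) by (rule subset_trans)
      then have "hat (Everyone (f (Suc j))) \<subseteq> hat (Everyone p)"
        by (rule hat_Everyone_mono)
      then show ?thesis
        using f(3)[of j] by (rule subset_trans[rotated])
    qed
    then have "L (f j \<^bold>\<rightarrow> Everyone p \<^bold>\<and> Everyone (f (Suc j)))" for j
      using f(3) by (simp add: L_Imp_iff hat_Conj)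
    then have "hat c \<subseteq> hat (Com p)"
      using B_omega[of f p] f(1) f0 by (simp add: L_Imp_iff)
    then show "w \<in> hat (Com p)"
      using c(2) by blast
  qed
qed

primrec val :: "'i fm \<Rightarrow> 'w set" where
  "val (Var n) = hat (Var n)"
| "val Fls = {}"
| "val (p \<^bold>\<rightarrow> q) = val q \<union> (W - val p)"
| "val (Box i p) = T i interior_of val p"
| "val (Com p) = inter_topology T interior_of val p"

lemma topological_model_val: "topological_model W T val"
proof -
  have "val p \<subseteq> W" for p
  proof (induction p)
    case (Com p)
    then show ?case
      using interior_of_subset[of "inter_topology T" "val p"] by auto
  qed (use hat_subset topspace_T interior_of_subset_topspace in fastforce)+
  then show ?thesis
    by (simp add: topological_model_def topspace_T)
qed

lemma val_eq_hat: "p \<in> B \<Longrightarrow> val p = hat p"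
proof (induction p)
  case (Box i p)
  then show ?case
    using B_Box[OF Box.prems] by (simp add: interior_of_Box)
next
  case (Com p)
  then show ?case
    using B_Com[OF Com.prems] by (simp add: interior_of_Com)
qed (simp_all add: hat_Fls hat_Imp B_Imp)

end

section \<open>The two derivability relations as logics\<close>

lemma S4C_theorem_in_logic:
  assumes "s4c_logic L" "S4C_theorem p"
  shows "L p"
  using assms(2)
proof induction
  case (ax p)
  then show ?case
    by (rule s4c_logic.L_axiom[OF assms(1)])
next
  case (mp p q)
  show ?case
    using s4c_logic.L_mp[OF assms(1) mp.IH] .
next
  case (nec p)
  show ?case
    using s4c_logic.L_nec[OF assms(1) nec.IH] .
qed

lemma s4c_logic_S4C_theorem: "s4c_logic S4C_theorem"
  by (rule s4c_logic.intro) (fact S4C_theorem.intros)+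

lemma derivable_global_assumption: "s \<in> \<Sigma> \<Longrightarrow> \<Sigma> \<turnstile>\<^sub>g s"
  unfolding derivable_global_def by (intro exI[of _ "Leaf s"]) auto

lemma derivable_global_omega:
  assumes "\<And>j. \<Sigma> \<turnstile>\<^sub>g f j \<^bold>\<rightarrow> Everyone q \<^bold>\<and> Everyone (f (Suc j))"
  shows "\<Sigma> \<turnstile>\<^sub>g f (0::nat) \<^bold>\<rightarrow> Com q"
proof -
  obtain ds where ds: "\<And>j. omega_derivation (ds j)" "\<And>j. assumptions (ds j) \<subseteq> \<Sigma>"
    "\<And>j. root (ds j) = (f j \<^bold>\<rightarrow> Everyone q \<^bold>\<and> Everyone (f (Suc j)))"
    using assms unfolding derivable_global_def by metis
  show ?thesis
    unfolding derivable_global_def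
  proof (intro exI conjI)
    show "omega_derivation (Omega (f 0 \<^bold>\<rightarrow> Com q) ds)"
      using ds(1,3) by auto
    show "assumptions (Omega (f 0 \<^bold>\<rightarrow> Com q) ds) \<subseteq> \<Sigma>"
      using ds(2) by auto
  qed simp
qed

lemma s4c_logic_derivable_global: "s4c_logic (\<lambda>p. \<Sigma> \<turnstile>\<^sub>g p)"
proof
  show "\<Sigma> \<turnstile>\<^sub>g p" if "S4C_axiom p" for p
    unfolding derivable_global_def using that by (intro exI[of _ "Leaf p"]) auto
  show "\<Sigma> \<turnstile>\<^sub>g q" if pq: "\<Sigma> \<turnstile>\<^sub>g p" "\<Sigma> \<turnstile>\<^sub>g p \<^bold>\<rightarrow> q" for p q
  proof -
    obtain d e where "omega_derivation d" "root d = p" "assumptions d \<subseteq> \<Sigma>"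
      "omega_derivation e" "root e = (p \<^bold>\<rightarrow> q)" "assumptions e \<subseteq> \<Sigma>"
      using pq unfolding derivable_global_def by blast
    then show ?thesis
      unfolding derivable_global_def by (intro exI[of _ "MP q d e"]) auto
  qed
  show "\<Sigma> \<turnstile>\<^sub>g Com p" if p: "\<Sigma> \<turnstile>\<^sub>g p" for p
  proof -
    obtain d where "omega_derivation d" "root d = p" "assumptions d \<subseteq> \<Sigma>"
      using p unfolding derivable_global_def by blast
    then show ?thesis
      unfolding derivable_global_def by (intro exI[of _ "Nec (Com p) d"]) auto
  qed
qed

section \<open>Conservativity of the infinitary rule over the finitary calculus\<close>

text \<open>The variables and modal subformulas of a formula, including those below other modal operators. A formula
  whose atoms lie in \<open>C\<close> is a Boolean combination of members of \<open>C\<close>, and all its subformulas have the same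
  property.\<close>

primrec atoms :: "'i fm \<Rightarrow> 'i fm set" where
  "atoms (Var n) = {Var n}"
| "atoms Fls = {}"
| "atoms (p \<^bold>\<rightarrow> q) = atoms p \<union> atoms q"
| "atoms (Box i p) = insert (Box i p) (atoms p)"
| "atoms (Com p) = insert (Com p) (atoms p)"

lemma finite_atoms: "finite (atoms p)"
  by (induction p) auto

lemma prop_eval_cong_atoms:
  "(\<And>a. a \<in> atoms p \<Longrightarrow> h a \<longleftrightarrow> k a) \<Longrightarrow> prop_eval h p \<longleftrightarrow> prop_eval k p"
  by (induction p) auto

text \<open>If the atoms of \<open>q\<close> lie in \<open>C\<close>, then whether a world satisfies \<open>q\<close> depends only on which members
  of \<open>C\<close> it contains. So \<open>hat q\<close> is determined by a set of subsets of \<open>C\<close>.\<close>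

lemma (in canonical_worlds) finite_hat_atoms:
  assumes "finite C"
  shows "finite (hat ` {q. atoms q \<subseteq> C})"
proof (rule finite_surj)
  show "finite (Pow (Pow C))"
    using assms by simp
  show "hat ` {q. atoms q \<subseteq> C} \<subseteq> (\<lambda>S. {w \<in> W. C \<inter> th w \<in> S}) ` Pow (Pow C)"
  proof (rule image_subsetI)
    fix q
    assume "q \<in> {q. atoms q \<subseteq> C}"
    then have q: "atoms q \<subseteq> C"
      by simp
    have "prop_eval (\<lambda>a. a \<in> C \<inter> th w) q \<longleftrightarrow> w \<in> hat q" if "w \<in> W" for w
    proof -
      have "prop_eval (\<lambda>a. a \<in> C \<inter> th w) q \<longleftrightarrow> prop_eval (\<lambda>a. w \<in> hat a) q"
        using q that by (intro prop_eval_cong_atoms) (auto simp: hat_def)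
      then show ?thesis
        using prop_eval_hat[OF that] by simp
    qed
    then have "hat q = {w \<in> W. C \<inter> th w \<in> {S \<in> Pow C. prop_eval (\<lambda>a. a \<in> S) q}}"
      using hat_subset by auto
    then show "hat q \<in> (\<lambda>S. {w \<in> W. C \<inter> th w \<in> S}) ` Pow (Pow C)"
      by (rule image_eqI) auto
  qed
qed

text \<open>The canonical model is built over the fragment of formulas whose atoms occur in \<open>p\<close>. For sequences in this fragment
  the rule \<open>\<omega>\<close> is derivable by \<open>omega_rule_finite\<close>, so the truth lemma applies to \<open>p\<close>. On the other
  hand \<open>p\<close> is valid in the model by soundness.\<close>

lemma omega_conservative:
  fixes p :: "'i::finite fm"
  assumes "{} \<turnstile>\<^sub>g p"
  shows "S4C_theorem p"
proof -
  interpret s4c_logic S4C_theorem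
    by (rule s4c_logic_S4C_theorem)
  interpret w: canonical_worlds S4C_theorem "Collect maximal_consistent" id
    by unfold_locales simp
  interpret canonical_model S4C_theorem "Collect maximal_consistent" id "{q. atoms q \<subseteq> atoms p}"
  proof
    show "S4C_theorem (f 0 \<^bold>\<rightarrow> Com q)"
      if f: "\<And>j. f j \<in> {q. atoms q \<subseteq> atoms p}"
        and prem: "\<And>j. S4C_theorem (f j \<^bold>\<rightarrow> Everyone q \<^bold>\<and> Everyone (f (Suc j)))"
      for f :: "nat \<Rightarrow> 'i fm" and q
    proof (rule w.omega_rule_finite[of f q, OF _ prem])
      have "range (\<lambda>j. w.hat (f j)) \<subseteq> w.hat ` {q. atoms q \<subseteq> atoms p}"
        using f by auto
      then show "finite (range (\<lambda>j. w.hat (f j)))"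
        using w.finite_hat_atoms[OF finite_atoms] finite_subset by blast
    qed
  qed auto
  have "alg_global TYPE(nat) {} p"
    using assms by (rule derivable_global_imp_alg_global)
  then have "top_global TYPE('i fm set) {} p"
    by (rule alg_global_imp_top_global[OF infinite_UNIV_nat])
  then have "val p = Collect maximal_consistent"
    using topological_model_val by (auto simp: top_global_def)
  then show ?thesis
    by (simp add: val_eq_hat w.L_iff_hat)
qed

section \<open>Completeness with respect to topological models\<close>

locale omega_logic = s4c_logic L for L :: "'i::finite fm \<Rightarrow> bool" +
  assumes L_omega: "(\<And>j. L (f j \<^bold>\<rightarrow> Everyone q \<^bold>\<and> Everyone (f (Suc j)))) \<Longrightarrow> L (f (0::nat) \<^bold>\<rightarrow> Com q)"

text \<open>All formulas are admitted in the base, so truth in the canonical model is membership for every formula.\<close>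

lemma (in omega_logic) canonical_completeness:
  assumes inj: "inj (g :: 'i fm set \<Rightarrow> 'x)"
  shows top_local_imp_entails: "top_local TYPE('x) \<Gamma> p \<Longrightarrow> entails \<Gamma> p"
    and top_global_imp_L: "top_global TYPE('x) \<Sigma> p \<Longrightarrow> (\<And>s. s \<in> \<Sigma> \<Longrightarrow> L s) \<Longrightarrow> L p"
proof -
  interpret canonical_model L "g ` Collect maximal_consistent" "inv g" UNIV
  proof
    show "inv g ` g ` Collect maximal_consistent = Collect maximal_consistent"
      using inj by (simp add: image_image)
  qed (auto intro: L_omega)
  have val: "val q = hat q" for q
    by (rule val_eq_hat) simp
  show "entails \<Gamma> p" if loc: "top_local TYPE('x) \<Gamma> p"
  proof (rule ccontr)
    assume "\<not> entails \<Gamma> p"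
    then obtain x where x: "maximal_consistent x" "\<Gamma> \<subseteq> x" "p \<notin> x"
      using maximal_consistent_extension by metis
    have hat_x: "g x \<in> hat q \<longleftrightarrow> q \<in> x" for q
      using x(1) inj by (simp add: hat_def)
    have "g x \<in> val p"
      using loc[unfolded top_local_def, rule_format, OF topological_model_val, of "g x"] x(1,2) hat_x val
      by auto
    then show False
      using x(3) hat_x val by simp
  qed
  show "L p" if glob: "top_global TYPE('x) \<Sigma> p" and \<Sigma>: "\<And>s. s \<in> \<Sigma> \<Longrightarrow> L s"
    using glob[unfolded top_global_def, rule_format, OF topological_model_val] \<Sigma>
    by (simp add: val L_iff_hat)
qed

text \<open>The premises are theorems, hence globally derivable from no assumptions. The rule \<open>\<omega>\<close> may be applied to them
  there, and by conservativity the conclusion is a theorem again.\<close>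

lemma omega_logic_S4C_theorem: "omega_logic S4C_theorem"
proof (intro omega_logic.intro omega_logic_axioms.intro)
  show "S4C_theorem (f (0::nat) \<^bold>\<rightarrow> Com q)"
    if prem: "\<And>j. S4C_theorem (f j \<^bold>\<rightarrow> Everyone q \<^bold>\<and> Everyone (f (Suc j)))" for f q
  proof (rule omega_conservative, rule derivable_global_omega)
    show "{} \<turnstile>\<^sub>g f j \<^bold>\<rightarrow> Everyone q \<^bold>\<and> Everyone (f (Suc j))" for j
      by (rule S4C_theorem_in_logic[OF s4c_logic_derivable_global prem])
  qed
qed (rule s4c_logic_S4C_theorem)

lemma omega_logic_derivable_global: "omega_logic (\<lambda>p. \<Sigma> \<turnstile>\<^sub>g p)"
  by (intro omega_logic.intro omega_logic_axioms.intro s4c_logic_derivable_global)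
    (rule derivable_global_omega)

lemma top_local_imp_derivable_local:
  fixes \<Gamma> :: "'i::finite fm set" and g :: "'i fm set \<Rightarrow> 'x"
  assumes "inj g" "top_local TYPE('x) \<Gamma> p"
  shows "\<Gamma> \<turnstile>\<^sub>l p"
proof -
  interpret omega_logic "S4C_theorem :: 'i fm \<Rightarrow> bool"
    by (rule omega_logic_S4C_theorem)
  show ?thesis
    using top_local_imp_entails[OF assms] by (simp add: derivable_local_def entails_def)
qed

lemma top_global_imp_derivable_global:
  fixes \<Sigma> :: "'i::finite fm set" and g :: "'i fm set \<Rightarrow> 'x"
  assumes "inj g" "top_global TYPE('x) \<Sigma> p"
  shows "\<Sigma> \<turnstile>\<^sub>g p"
proof -
  interpret omega_logic "\<lambda>p. \<Sigma> \<turnstile>\<^sub>g p"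
    by (rule omega_logic_derivable_global)
  show ?thesis
    by (rule top_global_imp_L[OF assms]) (rule derivable_global_assumption)
qed

theorem corollary2:
  fixes \<Gamma> \<Sigma> :: "'i::finite fm set" and \<phi> :: "'i fm"
  assumes "infinite (UNIV :: 'a set)"
    and "\<exists>f :: nat set \<Rightarrow> 'x. inj f"
  shows "(\<Gamma> \<turnstile>\<^sub>l \<phi> \<longleftrightarrow> alg_local TYPE('a) \<Gamma> \<phi>) \<and>
         (alg_local TYPE('a) \<Gamma> \<phi> \<longleftrightarrow> top_local TYPE('x) \<Gamma> \<phi>) \<and>
         (\<Sigma> \<turnstile>\<^sub>g \<phi> \<longleftrightarrow> alg_global TYPE('a) \<Sigma> \<phi>) \<and>
         (alg_global TYPE('a) \<Sigma> \<phi> \<longleftrightarrow> top_global TYPE('x) \<Sigma> \<phi>)"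
proof -
  obtain f :: "nat set \<Rightarrow> 'x" where "inj f"
    using assms(2) by blast
  moreover have "inj (image to_nat :: 'i fm set \<Rightarrow> nat set)"
    by (rule injI) (simp add: inj_image_eq_iff)
  ultimately have g: "inj (f \<circ> image (to_nat :: 'i fm \<Rightarrow> nat))"
    by (rule inj_compose)
  show ?thesis
    using derivable_local_imp_alg_local[of \<Gamma> \<phi>] alg_local_imp_top_local[OF assms(1), of \<Gamma> \<phi>]
      top_local_imp_derivable_local[OF g, of \<Gamma> \<phi>]
      derivable_global_imp_alg_global[of \<Sigma> \<phi>] alg_global_imp_top_global[OF assms(1), of \<Sigma> \<phi>]
      top_global_imp_derivable_global[OF g, of \<Sigma> \<phi>]
    by blast
qed

end
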